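(* Let $X$ be a finite-dimensional inner product space over $\mathbb{R}$ (real case) or over $\mathbb{C}$ with Hermitian product (complex case), and let $V,W\subset X$ be subspaces. If $\dim V=\dim W=p$ then, for any nonzero blades $\nu\in \Lambda^p V$ and $\omega\in \Lambda^p W$, \[ \pi_{V,W} = \begin{cases} \dfrac{|\langle\nu,\omega\rangle|}{\|\nu\|\,\|\omega\|} & \text{in the real case}, \\[8pt] \dfrac{|\langle\nu,\omega\rangle|^2}{\|\nu\|^2\|\omega\|^2} & \text{in the complex case}. \end{cases} \]
   Context: Subspaces, dimension and exterior powers are taken over the same field as $X$. A complex space is also regarded as a real inner product space with inner product $\operatorname{Re}\langle\cdot,\cdot\rangle$. On any subspace $U\subset X$, $|\cdot|_m$ denotes the $m$-dimensional Lebesgue measure of $U$ if $m=\dim_{\mathbb{R}} U$, and $|\cdot|_m=0$ if $m>\dim_{\mathbb{R}}U$. Projection factor: for subspaces $V,W\subset X$, let $P:V\to W$ be the orthogonal projection and $d=\dim_{\mathbb{R}}V$; then $\pi_{V,W}=|P(S)|_d/|S|_d$, where $S$ is any Lebesgue measurable subset of $V$ with $|S|_d\neq 0$ and $|P(S)|_d$ is taken in the subspace $P(V)$ (the ratio does not depend on $S$). A $p$-blade is a decomposable $p$-vector $\nu=v_1\wedge\cdots\wedge v_p\in\Lambda^pX$. The inner product (Hermitian in the complex case) on $\Lambda^pX$ is the linear (sesquilinear) extension of $\langle v_1\wedge\cdots\wedge v_p,\,w_1\wedge\cdots\wedge w_p\rangle=\det(\langle v_i,w_j\rangle)$, and $\|\nu\|=\sqrt{\langle\nu,\nu\rangle}$.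 *)

theory Defs
  imports
    "HOL-Analysis.Analysis"
    "HOL-Library.Poly_Mapping"
    "Jordan_Normal_Form.Determinant"
begin

section \<open>Complex inner product spaces\<close>

text \<open>
  A complex inner product space, carrying its structure of a real inner product space with
  real inner product the real part of the Hermitian one. The Hermitian product is
  conjugate-linear in its first argument. Definiteness need not be assumed: \<open>cinner x x\<close> is
  real by conjugate symmetry, hence equals \<open>inner x x\<close>.
\<close>

class complex_inner = real_inner +
  fixes scaleC :: "complex \<Rightarrow> 'a \<Rightarrow> 'a" (infixr \<open>*\<^sub>C\<close> 75)
    and cinner :: "'a \<Rightarrow> 'a \<Rightarrow> complex"
  assumes scaleC_add_right: "c *\<^sub>C (x + y) = c *\<^sub>C x + c *\<^sub>C y"
    and scaleC_add_left: "(c + d) *\<^sub>C x = c *\<^sub>C x + d *\<^sub>C x"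
    and scaleC_scaleC: "c *\<^sub>C d *\<^sub>C x = (c * d) *\<^sub>C x"
    and scaleC_one: "1 *\<^sub>C x = x"
    and scaleR_scaleC: "scaleR r x = complex_of_real r *\<^sub>C x"
    and cinner_commute: "cinner x y = cnj (cinner y x)"
    and cinner_add_right: "cinner x (y + z) = cinner x y + cinner x z"
    and cinner_scaleC_right: "cinner x (c *\<^sub>C y) = c * cinner x y"
    and inner_eq_Re_cinner: "inner x y = Re (cinner x y)"

global_interpretation complex_vector:
  vector_space "scaleC :: complex \<Rightarrow> 'a \<Rightarrow> 'a::complex_inner"
  by standard (simp_all add: scaleC_add_right scaleC_add_left scaleC_scaleC scaleC_one)

text \<open>The standard models: the complex numbers and, from them, complex coordinate space.\<close>

instantiation complex :: complex_inner
begin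

definition scaleC_complex :: "complex \<Rightarrow> complex \<Rightarrow> complex" where
  "scaleC_complex c x = c * x"

definition cinner_complex :: "complex \<Rightarrow> complex \<Rightarrow> complex" where
  "cinner_complex x y = cnj x * y"

instance
  by standard
    (simp_all add: scaleC_complex_def cinner_complex_def algebra_simps scaleR_conv_of_real
      inner_complex_def)

end

instantiation Finite_Cartesian_Product.vec :: (complex_inner, finite) complex_inner
begin

definition scaleC_vec :: "complex \<Rightarrow> ('a, 'b) Finite_Cartesian_Product.vec \<Rightarrow> ('a, 'b) Finite_Cartesian_Product.vec" where
  "scaleC_vec c x = vec_lambda (\<lambda>i. c *\<^sub>C vec_nth x i)"

definition cinner_vec :: "('a, 'b) Finite_Cartesian_Product.vec \<Rightarrow> ('a, 'b) Finite_Cartesian_Product.vec \<Rightarrow> complex" where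
  "cinner_vec x y = (\<Sum>i\<in>UNIV. cinner (vec_nth x i) (vec_nth y i))"

instance
proof
  fix x y :: "('a, 'b) Finite_Cartesian_Product.vec"
  show "cinner x y = cnj (cinner y x)"
    unfolding cinner_vec_def cnj_sum by (rule sum.cong[OF refl], rule cinner_commute)
qed (simp_all add: scaleC_vec_def cinner_vec_def Finite_Cartesian_Product.vec_eq_iff inner_vec_def
      scaleC_add_right scaleC_add_left scaleC_scaleC scaleC_one scaleR_scaleC cinner_add_right
      cinner_scaleC_right sum.distrib sum_distrib_left inner_eq_Re_cinner)

end

section \<open>Lebesgue measure on subspaces and the projection factor\<close>

definition orthonormal_basis_of :: "'a::real_inner list \<Rightarrow> 'a set \<Rightarrow> bool" where
  "orthonormal_basis_of bs U \<longleftrightarrow>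
     span (set bs) = U \<and>
     (\<forall>i<length bs. \<forall>j<length bs. inner (bs ! i) (bs ! j) = (if i = j then 1 else 0))"

text \<open>
  Lebesgue measure on a finite-dimensional subspace \<open>U\<close> is transported from coordinate space
  \<open>\<real>\<^sup>n\<close>, modelled as the functions on \<open>{..<n}\<close>, along the coordinates of an orthonormal basis.
  The result does not depend on the basis. For \<open>n = 0\<close> it is the unit mass at \<open>0\<close>.
\<close>

definition lebesgue_subspace :: "'a::real_inner set \<Rightarrow> 'a measure" where
  "lebesgue_subspace U =
     (let bs = (SOME bs. orthonormal_basis_of bs U)
      in embed_measure (completion (Pi\<^sub>M {..<length bs} (\<lambda>_. lborel)))
           (\<lambda>x. \<Sum>i<length bs. x i *\<^sub>R (bs ! i)))"

text \<open>
  The measure of \<open>S\<close> as a subset of the subspace \<open>U\<close> in dimension \<open>m\<close>: zero if \<open>m > dim U\<close>.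
  The case \<open>m < dim U\<close> is immaterial.
\<close>

definition subspace_vol :: "nat \<Rightarrow> 'a::real_inner set \<Rightarrow> 'a set \<Rightarrow> ennreal" where
  "subspace_vol m U S = (if m = dim U then emeasure (lebesgue_subspace U) S else 0)"

text \<open>
  For a complex subspace \<open>W\<close>, orthogonality to \<open>W\<close> with respect to the real inner product and
  with respect to the Hermitian product agree, so this covers both cases.
\<close>

definition orth_proj :: "'a::real_inner set \<Rightarrow> 'a \<Rightarrow> 'a" where
  "orth_proj W x = (THE w. w \<in> W \<and> (\<forall>u\<in>W. inner (x - w) u = 0))"

text \<open>
  The common value of the ratios \<open>|P(S)| / |S|\<close>, where \<open>S\<close> ranges over all measurable sets for
  which the ratio makes sense, i.e. those of nonzero finite measure. The dimension is the real one
  also when the space is complex.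
\<close>

definition projection_factor :: "'a::real_inner set \<Rightarrow> 'a set \<Rightarrow> real" where
  "projection_factor V W =
     (THE c. 0 \<le> c \<and>
        (\<forall>S\<in>sets (lebesgue_subspace V).
           subspace_vol (dim V) V S \<noteq> 0 \<longrightarrow> subspace_vol (dim V) V S \<noteq> \<infinity> \<longrightarrow>
             subspace_vol (dim V) (orth_proj W ` V) (orth_proj W ` S) / subspace_vol (dim V) V S
               = ennreal c))"

section \<open>Exterior powers\<close>

text \<open>
  The exterior power \<open>\<Lambda>\<^sup>p X\<close> over a field is the quotient of the free vector space on the
  \<open>p\<close>-tuples of vectors (lists of length \<open>p\<close>) by the subspace generated by the relations of
  multilinearity and alternation. A tuple \<open>vs\<close> stands in the free space as
  \<open>Poly_Mapping.single vs 1\<close>.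
\<close>

inductive_set wedge_relations ::
    "('k::field \<Rightarrow> 'a::ab_group_add \<Rightarrow> 'a) \<Rightarrow> nat \<Rightarrow> ('a list \<Rightarrow>\<^sub>0 'k) set"
  for smul :: "'k \<Rightarrow> 'a \<Rightarrow> 'a" and p :: nat
where
  zero: "0 \<in> wedge_relations smul p"
| add: "\<lbrakk>x \<in> wedge_relations smul p; y \<in> wedge_relations smul p\<rbrakk>
    \<Longrightarrow> x + y \<in> wedge_relations smul p"
| smult: "x \<in> wedge_relations smul p \<Longrightarrow> Poly_Mapping.map ((*) c) x \<in> wedge_relations smul p"
| slot_add: "length (us @ v # ws) = p \<Longrightarrow>
    Poly_Mapping.single (us @ (v + v') # ws) 1
      - Poly_Mapping.single (us @ v # ws) 1 - Poly_Mapping.single (us @ v' # ws) 1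
      \<in> wedge_relations smul p"
| slot_scale: "length (us @ v # ws) = p \<Longrightarrow>
    Poly_Mapping.single (us @ smul c v # ws) 1 - Poly_Mapping.single (us @ v # ws) c
      \<in> wedge_relations smul p"
| alternating: "length (us @ v # vs @ v # ws) = p \<Longrightarrow>
    Poly_Mapping.single (us @ v # vs @ v # ws) 1 \<in> wedge_relations smul p"

text \<open>The \<open>p\<close>-vectors are the cosets \<open>pvector smul p x\<close> with \<open>x\<close> supported on lists of length \<open>p\<close>.\<close>

definition pvector ::
    "('k::field \<Rightarrow> 'a::ab_group_add \<Rightarrow> 'a) \<Rightarrow> nat \<Rightarrow> ('a list \<Rightarrow>\<^sub>0 'k) \<Rightarrow> ('a list \<Rightarrow>\<^sub>0 'k) set" where
  "pvector smul p x = {y. y - x \<in> wedge_relations smul p}"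

text \<open>
  The blades of \<open>\<Lambda>\<^sup>p U\<close>, inside \<open>\<Lambda>\<^sup>p X\<close>: the coset below is \<open>c\<close> times the wedge product of \<open>vs\<close>.
  For \<open>p \<ge> 1\<close> the scalar \<open>c\<close> can be absorbed into a vector of the subspace \<open>U\<close>; for \<open>p = 0\<close> it
  makes every scalar a blade.
\<close>

definition blades ::
    "('k::field \<Rightarrow> 'a::ab_group_add \<Rightarrow> 'a) \<Rightarrow> nat \<Rightarrow> 'a set \<Rightarrow> ('a list \<Rightarrow>\<^sub>0 'k) set set" where
  "blades smul p U =
     {pvector smul p (Poly_Mapping.single vs c) | vs c. length vs = p \<and> set vs \<subseteq> U}"

text \<open>
  The sesquilinear extension to the free space of the Gram determinant of tuples; \<open>cj\<close> is the
  conjugation of the field (the identity over the reals) and \<open>ip\<close> the inner product of \<open>X\<close>.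
  It vanishes when one argument is a relation, and so descends to \<open>p\<close>-vectors, where its value is
  the common value over all representatives.
\<close>

definition gram_form ::
    "('k::field \<Rightarrow> 'k) \<Rightarrow> ('a \<Rightarrow> 'a \<Rightarrow> 'k) \<Rightarrow> nat \<Rightarrow> ('a list \<Rightarrow>\<^sub>0 'k) \<Rightarrow> ('a list \<Rightarrow>\<^sub>0 'k) \<Rightarrow> 'k" where
  "gram_form cj ip p x y =
     (\<Sum>vs\<in>Poly_Mapping.keys x. \<Sum>ws\<in>Poly_Mapping.keys y.
        cj (Poly_Mapping.lookup x vs) * Poly_Mapping.lookup y ws *
        Determinant.det (Matrix.mat p p (\<lambda>(i, j). ip (vs ! i) (ws ! j))))"

definition pvector_inner ::
    "('k::field \<Rightarrow> 'k) \<Rightarrow> ('a \<Rightarrow> 'a \<Rightarrow> 'k) \<Rightarrow> nat \<Rightarrow>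
      ('a list \<Rightarrow>\<^sub>0 'k) set \<Rightarrow> ('a list \<Rightarrow>\<^sub>0 'k) set \<Rightarrow> 'k" where
  "pvector_inner cj ip p \<mu> \<nu> = (THE c. \<forall>x\<in>\<mu>. \<forall>y\<in>\<nu>. gram_form cj ip p x y = c)"

definition pvec_inner ::
    "nat \<Rightarrow> ('a::real_inner list \<Rightarrow>\<^sub>0 real) set \<Rightarrow> ('a list \<Rightarrow>\<^sub>0 real) set \<Rightarrow> real" where
  "pvec_inner p = pvector_inner (\<lambda>r. r) inner p"

definition pvec_norm :: "nat \<Rightarrow> ('a::real_inner list \<Rightarrow>\<^sub>0 real) set \<Rightarrow> real" where
  "pvec_norm p \<nu> = sqrt (pvec_inner p \<nu> \<nu>)"

definition pvec_cinner ::
    "nat \<Rightarrow> ('a::complex_inner list \<Rightarrow>\<^sub>0 complex) set \<Rightarrow> ('a list \<Rightarrow>\<^sub>0 complex) set \<Rightarrow> complex" where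
  "pvec_cinner p = pvector_inner cnj cinner p"

text \<open>A Hermitian square is a nonnegative real; \<open>Re\<close> only changes its type.\<close>

definition pvec_cnorm :: "nat \<Rightarrow> ('a::complex_inner list \<Rightarrow>\<^sub>0 complex) set \<Rightarrow> real" where
  "pvec_cnorm p \<nu> = sqrt (Re (pvec_cinner p \<nu> \<nu>))"

end

theory Submission
  imports Defs
begin

text \<open>
  Fix orthonormal bases \<open>e\<close> of \<open>V\<close> and \<open>f\<close> of \<open>W\<close>. Both sides of the formula are computed from the
  Gram matrix \<open>G\<close> with entries \<open>\<langle>e\<^sub>i, f\<^sub>j\<rangle>\<close>.

  On the algebraic side, the Gram form vanishes on the relations of the exterior power, so the inner
  product of two \<open>p\<close>-vectors is the Gram form of any representatives (\<open>pvector_inner_pvector\<close>).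
  Let \<open>\<nu>\<close> be \<open>c\<close> times the wedge product of \<open>v\<^sub>1, \<dots>, v\<^sub>p\<close> and let \<open>a\<close> be \<open>c\<close> times the determinant of
  the coordinates of the \<open>v\<^sub>j\<close> with respect to \<open>e\<close>; define \<open>b\<close> from \<open>\<omega>\<close> and \<open>f\<close> likewise.
  By multiplicativity of determinants, \<open>\<langle>\<nu>, \<omega>\<rangle> = cnj a * b * det G\<close>, \<open>\<langle>\<nu>, \<nu>\<rangle> = cnj a * a\<close> and
  \<open>\<langle>\<omega>, \<omega>\<rangle> = cnj b * b\<close>. A nonzero blade has linearly independent factors, because the wedge product of
  a dependent tuple is a relation; so \<open>a\<close> and \<open>b\<close> are nonzero (\<open>blade_inner_factor\<close>). The normalised
  absolute value of \<open>\<langle>\<nu>, \<omega>\<rangle>\<close> is therefore the absolute value of \<open>det G\<close>.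

  On the geometric side, in the real case, the projection \<open>V \<rightarrow> W\<close> has in coordinates the transpose of
  \<open>G\<close> as its matrix. A linear map multiplies Lebesgue measure by the absolute value of its determinant;
  for the product measure on functions on \<open>{..<n}\<close> this is shown by induction on \<open>n\<close>, with Fubini's
  theorem and a Schur complement (\<open>nn_integral_lborel_coord_affine\<close>). If \<open>det G = 0\<close>, the
  projection of \<open>V\<close> has smaller dimension and both sides are zero. Hence the projection factor is the
  absolute value of \<open>det G\<close> (\<open>projection_factor_eq_abs_det\<close>).

  In the complex case, the vectors \<open>e\<^sub>i\<close> and \<open>\<i> e\<^sub>i\<close> form a real orthonormal basis of \<open>V\<close>, and the real Gram
  matrix of size \<open>2p\<close> has the square of \<open>cmod (det G)\<close> as its determinant (\<open>fun_det_realify\<close>). This is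
  where the exponent 2 comes from.
\<close>

section \<open>Determinants of square arrays\<close>

text \<open>
  The determinant of the \<open>n\<close> by \<open>n\<close> array of the values \<open>a i j\<close> with \<open>i, j < n\<close>. Matrices are given as
  functions of two indices, since here they always come as families of inner products or coordinates.
\<close>

definition fun_det :: "nat \<Rightarrow> (nat \<Rightarrow> nat \<Rightarrow> 'a::comm_ring_1) \<Rightarrow> 'a" where
  "fun_det n a = Determinant.det (Matrix.mat n n (\<lambda>(i, j). a i j))"

lemma fun_det_cong:
  assumes "\<And>i j. i < n \<Longrightarrow> j < n \<Longrightarrow> a i j = b i j"
  shows "fun_det n a = fun_det n b"
  unfolding fun_det_def by (rule arg_cong[of _ _ Determinant.det], rule Matrix.eq_matI) (use assms in auto)

lemma fun_det_0 [simp]: "fun_det 0 a = 1"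
  by (simp add: fun_det_def)

lemma fun_det_one: "fun_det n (\<lambda>i j. if i = j then 1 else 0) = 1"
proof -
  have "Matrix.mat n n (\<lambda>(i, j). if i = j then 1 else 0) = 1\<^sub>m n"
    by (rule Matrix.eq_matI) auto
  then show ?thesis unfolding fun_det_def by (metis Determinant.det_one)
qed

lemma fun_det_transpose: "fun_det n (\<lambda>i j. a j i) = fun_det n a"
proof -
  have "Matrix.mat n n (\<lambda>(i, j). a j i) = transpose_mat (Matrix.mat n n (\<lambda>(i, j). a i j))"
    by (rule Matrix.eq_matI) auto
  then show ?thesis
    unfolding fun_det_def by (simp add: Determinant.det_transpose[of _ n])
qed

lemma fun_det_mult:
  "fun_det n (\<lambda>i j. \<Sum>k<n. a i k * b k j) = fun_det n a * fun_det n b"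
proof -
  have "Matrix.mat n n (\<lambda>(i, j). \<Sum>k<n. a i k * b k j)
      = Matrix.mat n n (\<lambda>(i, j). a i j) * Matrix.mat n n (\<lambda>(i, j). b i j)"
    by (rule Matrix.eq_matI) (auto simp: Matrix.scalar_prod_def lessThan_atLeast0)
  then show ?thesis
    unfolding fun_det_def by (simp add: Determinant.det_mult[of _ n])
qed

lemma fun_det_hom:
  assumes "comm_ring_hom h"
  shows "fun_det n (\<lambda>i j. h (a i j)) = h (fun_det n a)"
proof -
  interpret comm_ring_hom h by fact
  have "Matrix.mat n n (\<lambda>(i, j). h (a i j)) = map_mat h (Matrix.mat n n (\<lambda>(i, j). a i j))"
    by (rule Matrix.eq_matI) auto
  then show ?thesis unfolding fun_det_def by simp
qed

lemma fun_det_eq_0_kernel: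
  fixes a :: "nat \<Rightarrow> nat \<Rightarrow> 'a::field"
  assumes "fun_det n a = 0"
  obtains x k where "k < n" "x k \<noteq> 0" "\<And>i. i < n \<Longrightarrow> (\<Sum>j<n. a i j * x j) = 0"
proof -
  let ?A = "Matrix.mat n n (\<lambda>(i, j). a i j)"
  obtain v where v: "v \<in> carrier_vec n" "v \<noteq> 0\<^sub>v n" "?A *\<^sub>v v = 0\<^sub>v n"
    using assms Determinant.det_0_iff_vec_prod_zero_field[of ?A n] unfolding fun_det_def by auto
  have "\<exists>k<n. Matrix.vec_index v k \<noteq> 0"
  proof (rule ccontr)
    assume "\<not> ?thesis"
    then have "v = 0\<^sub>v n" using v(1) by (intro Matrix.eq_vecI) auto
    with v(2) show False by contradiction
  qed
  then obtain k where "k < n" "Matrix.vec_index v k \<noteq> 0" by blast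
  moreover have "(\<Sum>j<n. a i j * Matrix.vec_index v j) = 0" if "i < n" for i
  proof -
    have "Matrix.vec_index (?A *\<^sub>v v) i = (\<Sum>j<n. a i j * Matrix.vec_index v j)"
      using that v(1) by (auto simp: Matrix.scalar_prod_def lessThan_atLeast0)
    then show ?thesis using v(3) that by simp
  qed
  ultimately show ?thesis by (rule that)
qed

lemma fun_det_kernel_imp_0:
  fixes a :: "nat \<Rightarrow> nat \<Rightarrow> 'a::field"
  assumes "k < n" "x k \<noteq> 0" "\<And>i. i < n \<Longrightarrow> (\<Sum>j<n. a i j * x j) = 0"
  shows "fun_det n a = 0"
proof -
  let ?A = "Matrix.mat n n (\<lambda>(i, j). a i j)"
  have "Matrix.vec n x \<noteq> 0\<^sub>v n"
    using assms(1,2) by (metis Matrix.index_vec Matrix.index_zero_vec(1))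
  moreover have "?A *\<^sub>v Matrix.vec n x = 0\<^sub>v n"
    by (rule Matrix.eq_vecI) (auto simp: Matrix.scalar_prod_def lessThan_atLeast0[symmetric] assms(3))
  ultimately show ?thesis
    using Determinant.det_0_iff_vec_prod_zero_field[of ?A n] unfolding fun_det_def
    by (metis mat_carrier vec_carrier)
qed

lemma fun_det_inverse:
  fixes a :: "nat \<Rightarrow> nat \<Rightarrow> 'a::field"
  assumes "fun_det n a \<noteq> 0"
  obtains b where
    "\<And>i j. i < n \<Longrightarrow> j < n \<Longrightarrow> (\<Sum>k<n. a i k * b k j) = (if i = j then 1 else 0)"
    "\<And>i j. i < n \<Longrightarrow> j < n \<Longrightarrow> (\<Sum>k<n. b i k * a k j) = (if i = j then 1 else 0)"
proof -
  let ?A = "Matrix.mat n n (\<lambda>(i, j). a i j)"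
  obtain B where B: "B \<in> carrier_mat n n" "?A * B = 1\<^sub>m n" "B * ?A = 1\<^sub>m n"
    using det_non_zero_imp_unit[of ?A n] assms
    unfolding fun_det_def Units_def by (auto simp: ring_mat_def)
  show ?thesis
  proof
    fix i j assume ij: "i < n" "j < n"
    have "(\<Sum>k<n. a i k * B $$ (k, j)) = (?A * B) $$ (i, j)"
      using ij B(1) by (auto simp: Matrix.scalar_prod_def lessThan_atLeast0)
    then show "(\<Sum>k<n. a i k * B $$ (k, j)) = (if i = j then 1 else 0)" using ij B(2) by simp
    have "(\<Sum>k<n. B $$ (i, k) * a k j) = (B * ?A) $$ (i, j)"
      using ij B(1) by (auto simp: Matrix.scalar_prod_def lessThan_atLeast0)
    then show "(\<Sum>k<n. B $$ (i, k) * a k j) = (if i = j then 1 else 0)" using ij B(3) by simp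
  qed
qed

lemma fun_det_add_column:
  fixes a :: "nat \<Rightarrow> nat \<Rightarrow> 'a::field"
  assumes "k < n" "l < n" "k \<noteq> l"
  shows "fun_det n (\<lambda>i j. if j = l then a i l + a i k else a i j) = fun_det n a"
proof -
  let ?A = "Matrix.mat n n (\<lambda>(i, j). a j i)"
  have "Matrix.mat n n (\<lambda>(i, j). if i = l then a j l + a j k else a j i) = addrow 1 l k ?A"
    using assms by (intro Matrix.eq_matI) auto
  then have "fun_det n (\<lambda>i j. if i = l then a j l + a j k else a j i) = fun_det n (\<lambda>i j. a j i)"
    unfolding fun_det_def using assms by (simp add: Determinant.det_addrow[of k n])
  then show ?thesis
    unfolding fun_det_transpose[of n a] fun_det_transpose[of n "\<lambda>i j. if j = l then a i l + a i k else a i j"] .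
qed

text \<open>
  Expansion along the last row and column, with pivot \<open>a n n\<close>: the matrix is the product of an upper
  unitriangular matrix and a block lower triangular one whose diagonal blocks are the Schur complement
  of the pivot and the pivot.
\<close>

lemma fun_det_Suc_Schur:
  fixes a :: "nat \<Rightarrow> nat \<Rightarrow> 'a::field"
  assumes d: "a n n \<noteq> 0"
  shows "fun_det (Suc n) a = a n n * fun_det n (\<lambda>i j. a i j - a i n * a n j / a n n)"
proof -
  let ?s = "\<lambda>i j. a i j - a i n * a n j / a n n"
  let ?u = "\<lambda>i j. if i < n \<and> j = n then a i n / a n n else if i = j then 1 else 0"
  let ?l = "\<lambda>i j. if i < n \<and> j < n then ?s i j else if i = n then a n j else 0"
  have "fun_det (Suc n) a = fun_det (Suc n) (\<lambda>i j. \<Sum>k<Suc n. ?u i k * ?l k j)"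
  proof (rule fun_det_cong)
    fix i j assume ij: "i < Suc n" "j < Suc n"
    show "a i j = (\<Sum>k<Suc n. ?u i k * ?l k j)"
    proof (cases "i < n")
      case True
      have "(\<Sum>k<n. ?u i k * ?l k j) = (\<Sum>k<n. if k = i then ?l k j else 0)"
        by (rule sum.cong) auto
      then have "(\<Sum>k<n. ?u i k * ?l k j) = ?l i j" using True by simp
      then show ?thesis using True d ij by (cases "j = n") auto
    next
      case False
      then have "i = n" using ij by simp
      then have "(\<Sum>k<n. ?u i k * ?l k j) = 0" by (intro sum.neutral) auto
      then show ?thesis using \<open>i = n\<close> by simp
    qed
  qed
  also have "\<dots> = fun_det (Suc n) ?u * fun_det (Suc n) ?l" by (rule fun_det_mult)
  also have "fun_det (Suc n) ?u = 1"
  proof -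
    have "Matrix.mat (Suc n) (Suc n) (\<lambda>(i, j). ?u i j)
        = four_block_mat (1\<^sub>m n) (Matrix.mat n 1 (\<lambda>(i, j). a i n / a n n)) (0\<^sub>m 1 n) (1\<^sub>m 1)"
      by (rule Matrix.eq_matI) auto
    then show ?thesis
      unfolding fun_det_def
      by (simp add: det_four_block_mat_lower_left_zero[of "1\<^sub>m n" n _ 1])
  qed
  also have "fun_det (Suc n) ?l = fun_det n ?s * a n n"
  proof -
    have "Matrix.mat (Suc n) (Suc n) (\<lambda>(i, j). ?l i j)
        = four_block_mat (Matrix.mat n n (\<lambda>(i, j). ?s i j)) (0\<^sub>m n 1)
            (Matrix.mat 1 n (\<lambda>(i, j). a n j)) (Matrix.mat 1 1 (\<lambda>(i, j). a n n))"
      by (rule Matrix.eq_matI) (auto simp: less_Suc_eq)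
    moreover have "Determinant.det (Matrix.mat 1 1 (\<lambda>(i, j). a n n)) = a n n"
      by (simp add: Determinant.det_def)
    ultimately show ?thesis
      unfolding fun_det_def
      by (simp add: det_four_block_mat_upper_right_zero[of _ n _ 1])
  qed
  finally show ?thesis by simp
qed

lemma fun_det_column_linear:
  fixes a :: "nat \<Rightarrow> nat \<Rightarrow> 'a::comm_ring_1"
  assumes k: "k < n"
  shows "fun_det n (\<lambda>i j. if j = k then r * c i + d i else a i j)
    = r * fun_det n (\<lambda>i j. if j = k then c i else a i j) + fun_det n (\<lambda>i j. if j = k then d i else a i j)"
proof -
  have det: "fun_det n (\<lambda>i j. if j = k then c i else a i j)
      = (\<Sum>p | p permutes {0..<n}. signof p * (c (p k) * (\<Prod>j\<in>{..<n} - {k}. a (p j) j)))" for c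
  proof -
    have "fun_det n (\<lambda>i j. if j = k then c i else a i j)
        = (\<Sum>p | p permutes {0..<n}. signof p * (\<Prod>j<n. if j = k then c (p j) else a (p j) j))"
      unfolding fun_det_def
    proof (subst det_col[of _ n], simp, intro sum.cong refl arg_cong2[of _ _ _ _ "(*)"] prod.cong)
      fix p j assume "p \<in> {p. p permutes {0..<n}}" "j \<in> {..<n}"
      then have "p j < n" using permutes_in_image[of p "{0..<n}" j] by simp
      then show "Matrix.mat n n (\<lambda>(i, j). if j = k then c i else a i j) $$ (p j, j)
          = (if j = k then c (p j) else a (p j) j)"
        using \<open>j \<in> {..<n}\<close> by simp
    qed
    moreover have "(\<Prod>j<n. if j = k then c (p j) else a (p j) j)
        = c (p k) * (\<Prod>j\<in>{..<n} - {k}. a (p j) j)" for p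
      using k by (subst prod.remove[of _ k]) (auto intro!: arg_cong2[of _ _ _ _ "(*)"] prod.cong)
    ultimately show ?thesis by simp
  qed
  show ?thesis
    unfolding det by (simp add: sum_distrib_left sum.distrib[symmetric] algebra_simps)
qed

lemma fun_det_identical_columns:
  fixes a :: "nat \<Rightarrow> nat \<Rightarrow> 'a::comm_ring_1"
  assumes "k < n" "l < n" "k \<noteq> l" "\<And>i. i < n \<Longrightarrow> a i k = a i l"
  shows "fun_det n a = 0"
proof -
  have "Determinant.det (Matrix.mat n n (\<lambda>(i, j). a j i)) = 0"
    by (rule Determinant.det_identical_rows[of _ n k l]) (use assms in \<open>auto intro!: Matrix.eq_vecI\<close>)
  then show ?thesis using fun_det_transpose[of n a] by (simp add: fun_det_def)
qed

section \<open>Linear change of variables for product Lebesgue measure\<close>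

text \<open>
  Lebesgue measure on \<open>\<real>\<^sup>n\<close>, modelled as the functions on \<open>{..<n}\<close> that are \<open>undefined\<close> elsewhere. The
  dimension is a term here, so that it can be the dimension of a subspace and the variable of an
  induction.
\<close>

abbreviation lborel_coord :: "nat \<Rightarrow> (nat \<Rightarrow> real) measure" where
  "lborel_coord n \<equiv> Pi\<^sub>M {..<n} (\<lambda>_. lborel)"

interpretation lborel_product: product_sigma_finite "\<lambda>_::nat. lborel :: real measure"
  by standard

lemma nn_integral_lborel_coord_shear:
  assumes f[measurable]: "f \<in> borel_measurable (lborel_coord n)"
    and kl: "k < n" "l < n" "k \<noteq> l"
  shows "(\<integral>\<^sup>+x. f (x(k := x k + x l)) \<partial>lborel_coord n) = (\<integral>\<^sup>+x. f x \<partial>lborel_coord n)"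
proof -
  define K where "K = {..<n} - {k}"
  have I: "{..<n} = insert k K" and K: "finite K" "k \<notin> K" "l \<in> K"
    using kl by (auto simp: K_def)
  have upd: "(\<lambda>x. x(k := x k + x l)) \<in> measurable (lborel_coord n) (lborel_coord n)"
  proof -
    have "(\<lambda>x. \<lambda>i\<in>{..<n}. if i = k then x k + x l else x i) \<in> measurable (lborel_coord n) (lborel_coord n)"
      using kl by (intro measurable_restrict) auto
    moreover have "(\<lambda>i\<in>{..<n}. if i = k then x k + x l else x i) = x(k := x k + x l)"
      if "x \<in> space (lborel_coord n)" for x
      using that kl by (auto simp: space_PiM PiE_def extensional_def fun_eq_iff)
    ultimately show ?thesis by (simp cong: measurable_cong)
  qed
  have g: "(\<lambda>x. f (x(k := x k + x l))) \<in> borel_measurable (lborel_coord n)"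
    by (rule measurable_compose[OF upd f])
  have "(\<integral>\<^sup>+x. f (x(k := x k + x l)) \<partial>lborel_coord n)
      = (\<integral>\<^sup>+x. (\<integral>\<^sup>+y. f (x(k := y + x l)) \<partial>lborel) \<partial>Pi\<^sub>M K (\<lambda>_. lborel))"
    unfolding I using g[unfolded I] K kl
    by (subst lborel_product.product_nn_integral_insert) auto
  also have "\<dots> = (\<integral>\<^sup>+x. (\<integral>\<^sup>+y. f (x(k := y)) \<partial>lborel) \<partial>Pi\<^sub>M K (\<lambda>_. lborel))"
  proof (rule nn_integral_cong)
    fix x assume x: "x \<in> space (Pi\<^sub>M K (\<lambda>_. lborel :: real measure))"
    have "(\<lambda>y. x(k := y)) \<in> measurable borel (Pi\<^sub>M (insert k K) (\<lambda>_. lborel))"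
      using x K by (intro measurable_fun_upd[where J = K]) auto
    then have [measurable]: "(\<lambda>y. f (x(k := y))) \<in> borel_measurable borel"
      using f unfolding I[symmetric] by (rule measurable_compose)
    show "(\<integral>\<^sup>+y. f (x(k := y + x l)) \<partial>lborel) = (\<integral>\<^sup>+y. f (x(k := y)) \<partial>lborel)"
      by (subst nn_integral_real_affine[of "\<lambda>y. f (x(k := y))" 1 "x l"]) (auto simp: add.commute)
  qed
  also have "\<dots> = (\<integral>\<^sup>+x. f x \<partial>lborel_coord n)"
    using f K unfolding I by (subst lborel_product.product_nn_integral_insert) auto
  finally show ?thesis .
qed

text \<open>
  The change of variables formula for affine maps, by induction on the dimension. If the last diagonal
  entry is nonzero, an affine substitution in the last coordinate leaves a map of one dimension less,
  whose matrix is the Schur complement of the pivot and whose translation part depends on the last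
  coordinate; this is why affine maps are considered. Otherwise a shear first makes the pivot nonzero.
\<close>

lemma nn_integral_lborel_coord_affine:
  fixes a :: "nat \<Rightarrow> nat \<Rightarrow> real"
  assumes "fun_det n a \<noteq> 0" and "f \<in> borel_measurable (lborel_coord n)"
  shows "(\<integral>\<^sup>+x. f x \<partial>lborel_coord n) = ennreal \<bar>fun_det n a\<bar> *
    (\<integral>\<^sup>+x. f (\<lambda>i\<in>{..<n}. v i + (\<Sum>j<n. a i j * x j)) \<partial>lborel_coord n)"
  using assms
proof (induction n arbitrary: a v f)
  case 0
  then show ?case by (simp add: PiM_empty nn_integral_count_space_finite restrict_def)
next
  case (Suc n)
  let ?T = "\<lambda>a x. \<lambda>i\<in>{..<Suc n}. v i + (\<Sum>j<Suc n. a i j * x j)"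
  note f[measurable] = Suc.prems(2)
  have T: "?T a \<in> measurable (lborel_coord (Suc n)) (lborel_coord (Suc n))" for a
    by (intro measurable_restrict) measurable
  have fT: "(\<lambda>x. f (?T a x)) \<in> borel_measurable (lborel_coord (Suc n))" for a
    by (rule measurable_compose[OF T f])
  have pivot: "(\<integral>\<^sup>+x. f x \<partial>lborel_coord (Suc n)) = ennreal \<bar>fun_det (Suc n) a\<bar> *
      (\<integral>\<^sup>+x. f (?T a x) \<partial>lborel_coord (Suc n))"
    if det: "fun_det (Suc n) a \<noteq> 0" and d: "a n n \<noteq> 0" for a
  proof -
    \<comment> \<open>\<open>s\<close> is the Schur complement. \<open>R\<close> expresses the affine map in terms of the first \<open>n\<close> coordinates
      of the argument and the last coordinate \<open>u\<close> of the value; \<open>w u\<close> is the translation part.\<close>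
    define s where "s = (\<lambda>i j. a i j - a i n * a n j / a n n)"
    define w where "w = (\<lambda>u i. v i + a i n * (u - v n) / a n n)"
    define R where "R = (\<lambda>x. \<lambda>i\<in>{..<Suc n}. if i = n then x n else w (x n) i + (\<Sum>j<n. s i j * x j))"
    have R: "R \<in> measurable (lborel_coord (Suc n)) (lborel_coord (Suc n))"
      unfolding R_def w_def by (intro measurable_restrict) measurable
    have fR: "(\<lambda>x. f (R x)) \<in> borel_measurable (lborel_coord (Suc n))"
      by (rule measurable_compose[OF R f])
    have det_a: "fun_det (Suc n) a = a n n * fun_det n s"
      unfolding s_def by (rule fun_det_Suc_Schur[of a n, OF d])
    then have det_s: "fun_det n s \<noteq> 0" using det by simp
    have upd: "(\<lambda>y. x(n := y)) \<in> measurable borel (lborel_coord (Suc n))"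
      if "x \<in> space (lborel_coord n)" for x
      unfolding lessThan_Suc using that by (intro measurable_fun_upd[where J = "{..<n}"]) auto
    have upd': "(\<lambda>x. x(n := y)) \<in> measurable (lborel_coord n) (lborel_coord (Suc n))" for y
      unfolding lessThan_Suc by (intro measurable_fun_upd[where J = "{..<n}"]) auto
    have TR: "?T a (x(n := y)) = R (x(n := (v n + (\<Sum>j<n. a n j * x j)) + a n n * y))" for x y
    proof -
      have eq: "v i + ((\<Sum>j<n. a i j * x j) + a i n * y)
          = w ((v n + (\<Sum>j<n. a n j * x j)) + a n n * y) i + (\<Sum>j<n. s i j * x j)" for i
        using d unfolding w_def s_def
        by (simp add: algebra_simps sum_subtractf sum_distrib_left add_divide_distrib
            sum_divide_distrib)
      show ?thesis
      proof
        fix i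
        consider "i < n" | "i = n" | "i > n" by linarith
        then show "?T a (x(n := y)) i = R (x(n := (v n + (\<Sum>j<n. a n j * x j)) + a n n * y)) i"
        proof cases
          case 2
          moreover have "w u n = u" for u using d by (simp add: w_def)
          moreover have "s n j = 0" for j using d by (simp add: s_def)
          ultimately show ?thesis by (simp add: R_def)
        qed (simp_all add: R_def eq)
      qed
    qed
    \<comment> \<open>Substitution in the last coordinate, for fixed values of the others.\<close>
    have "\<bar>a n n\<bar> * (\<integral>\<^sup>+x. f (?T a x) \<partial>lborel_coord (Suc n))
        = \<bar>a n n\<bar> * (\<integral>\<^sup>+x. (\<integral>\<^sup>+y. f (?T a (x(n := y))) \<partial>lborel) \<partial>lborel_coord n)"
      using fT[of a] unfolding lessThan_Suc
      by (subst lborel_product.product_nn_integral_insert) auto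
    also have "\<dots> = (\<integral>\<^sup>+x. \<bar>a n n\<bar> * (\<integral>\<^sup>+y. f (?T a (x(n := y))) \<partial>lborel) \<partial>lborel_coord n)"
    proof (rule nn_integral_cmult[symmetric])
      have "(\<lambda>(x, y). x(n := y)) \<in> measurable (lborel_coord n \<Otimes>\<^sub>M lborel) (lborel_coord (Suc n))"
        unfolding lessThan_Suc by (rule measurable_add_dim)
      from measurable_compose[OF this fT[of a]]
      show "(\<lambda>x. \<integral>\<^sup>+y. f (?T a (x(n := y))) \<partial>lborel) \<in> borel_measurable (lborel_coord n)"
        by (intro sigma_finite_measure.borel_measurable_nn_integral[OF sigma_finite_lborel])
           (simp add: case_prod_beta')
    qed
    also have "\<dots> = (\<integral>\<^sup>+x. (\<integral>\<^sup>+u. f (R (x(n := u))) \<partial>lborel) \<partial>lborel_coord n)"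
    proof (rule nn_integral_cong)
      fix x assume x: "x \<in> space (lborel_coord n)"
      have "(\<lambda>u. f (R (x(n := u)))) \<in> borel_measurable borel"
        by (rule measurable_compose[OF upd[OF x] fR])
      then show "\<bar>a n n\<bar> * (\<integral>\<^sup>+y. f (?T a (x(n := y))) \<partial>lborel) = (\<integral>\<^sup>+u. f (R (x(n := u))) \<partial>lborel)"
        unfolding TR
        by (subst (2) nn_integral_real_affine[OF _ d, of _ "v n + (\<Sum>j<n. a n j * x j)"]) auto
    qed
    also have "\<dots> = (\<integral>\<^sup>+x. f (R x) \<partial>lborel_coord (Suc n))"
      using fR unfolding lessThan_Suc
      by (subst lborel_product.product_nn_integral_insert) auto
    also have "\<dots> = (\<integral>\<^sup>+u. (\<integral>\<^sup>+x. f (R (x(n := u))) \<partial>lborel_coord n) \<partial>lborel)"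
      using fR unfolding lessThan_Suc
      by (subst lborel_product.product_nn_integral_insert_rev) auto
    finally have 1: "\<bar>a n n\<bar> * (\<integral>\<^sup>+x. f (?T a x) \<partial>lborel_coord (Suc n)) = \<dots>" .
    have meas_u: "(\<lambda>u. \<integral>\<^sup>+x. f (R (x(n := u))) \<partial>lborel_coord n) \<in> borel_measurable lborel"
    proof -
      have "(\<lambda>(u, x). x(n := u)) \<in> measurable (lborel \<Otimes>\<^sub>M lborel_coord n) (lborel_coord (Suc n))"
        unfolding lessThan_Suc case_prod_beta'
        by (intro measurable_fun_upd[where J = "{..<n}"]) auto
      from measurable_compose[OF this fR]
      show ?thesis
        by (intro sigma_finite_measure.borel_measurable_nn_integral[OF lborel_product.sigma_finite])
           (simp_all add: case_prod_beta')
    qed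
    \<comment> \<open>The induction hypothesis, for each fixed value \<open>u\<close> of the last coordinate.\<close>
    have "ennreal \<bar>fun_det (Suc n) a\<bar> * (\<integral>\<^sup>+x. f (?T a x) \<partial>lborel_coord (Suc n))
        = \<bar>fun_det n s\<bar> * (\<bar>a n n\<bar> * (\<integral>\<^sup>+x. f (?T a x) \<partial>lborel_coord (Suc n)))"
      unfolding det_a abs_mult by (simp add: ennreal_mult mult_ac)
    also have "\<dots> = (\<integral>\<^sup>+u. \<bar>fun_det n s\<bar> * (\<integral>\<^sup>+x. f (R (x(n := u))) \<partial>lborel_coord n) \<partial>lborel)"
      unfolding 1 using meas_u by (rule nn_integral_cmult[symmetric])
    also have "\<dots> = (\<integral>\<^sup>+u. (\<integral>\<^sup>+x. f (x(n := u)) \<partial>lborel_coord n) \<partial>lborel)"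
    proof (rule nn_integral_cong)
      fix u :: real
      have Ru: "R (x(n := u)) = (\<lambda>i\<in>{..<n}. w u i + (\<Sum>j<n. s i j * x j))(n := u)" for x
        unfolding R_def by (auto simp: fun_eq_iff restrict_def)
      show "\<bar>fun_det n s\<bar> * (\<integral>\<^sup>+x. f (R (x(n := u))) \<partial>lborel_coord n)
          = (\<integral>\<^sup>+x. f (x(n := u)) \<partial>lborel_coord n)"
        unfolding Ru
        by (rule Suc.IH[OF det_s, symmetric]) (rule measurable_compose[OF upd' f])
    qed
    also have "\<dots> = (\<integral>\<^sup>+x. f x \<partial>lborel_coord (Suc n))"
      using f unfolding lessThan_Suc
      by (subst lborel_product.product_nn_integral_insert_rev) auto
    finally show ?thesis by simp
  qed
  show ?case
  proof (cases "a n n = 0")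
    case False
    then show ?thesis by (intro pivot Suc.prems)
  next
    case True
    \<comment> \<open>Otherwise the last row is zero, and the last unit vector is in the kernel of the transpose.\<close>
    have "\<exists>k<Suc n. a n k \<noteq> 0"
    proof (rule ccontr)
      assume "\<not> ?thesis"
      then have row: "(\<Sum>j<Suc n. a j i * (if j = n then 1 else 0)) = 0" if "i < Suc n" for i
        using that by (simp add: if_distrib[of "\<lambda>z. _ * z"] sum.delta cong: if_cong)
      have "fun_det (Suc n) (\<lambda>i j. a j i) = 0"
        by (rule fun_det_kernel_imp_0[of n "Suc n" "\<lambda>j. if j = n then 1 else 0"])
           (use row in auto)
      then show False using Suc.prems(1) unfolding fun_det_transpose[of "Suc n" a] by contradiction
    qed
    then obtain k where k: "k < n" "a n k \<noteq> 0" using True less_Suc_eq by auto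
    \<comment> \<open>Adding column \<open>k\<close> to the last one amounts to a shear of the argument.\<close>
    define a' where "a' = (\<lambda>i j. if j = n then a i n + a i k else a i j)"
    have det': "fun_det (Suc n) a' = fun_det (Suc n) a"
      unfolding a'_def by (rule fun_det_add_column) (use k in auto)
    have T': "?T a' x = ?T a (x(k := x k + x n))" for x
    proof -
      have "(\<Sum>j<n. a i j * (if j = k then x k + x n else x j))
          = (\<Sum>j<n. a i j * x j + (if j = k then a i k * x n else 0))" for i
        by (rule sum.cong) (auto simp: algebra_simps)
      then show ?thesis
        unfolding a'_def using k by (auto simp: fun_eq_iff restrict_def sum.distrib algebra_simps)
    qed
    have "(\<integral>\<^sup>+x. f x \<partial>lborel_coord (Suc n))
        = \<bar>fun_det (Suc n) a'\<bar> * (\<integral>\<^sup>+x. f (?T a' x) \<partial>lborel_coord (Suc n))"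
      by (rule pivot) (use det' Suc.prems(1) k True in \<open>auto simp: a'_def\<close>)
    also have "\<dots> = \<bar>fun_det (Suc n) a\<bar> * (\<integral>\<^sup>+x. f (?T a x) \<partial>lborel_coord (Suc n))"
      unfolding T' det'
      by (subst nn_integral_lborel_coord_shear[OF fT]) (use k in auto)
    finally show ?thesis .
  qed
qed

text \<open>
  The linear map of \<open>\<real>\<^sup>n\<close> with matrix \<open>a\<close>.
\<close>

definition coord_map :: "nat \<Rightarrow> (nat \<Rightarrow> nat \<Rightarrow> real) \<Rightarrow> (nat \<Rightarrow> real) \<Rightarrow> nat \<Rightarrow> real" where
  "coord_map n a x = (\<lambda>i\<in>{..<n}. \<Sum>j<n. a i j * x j)"

lemma coord_map_space: "coord_map n a x \<in> space (lborel_coord n)"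
  by (simp add: coord_map_def space_PiM)

lemma measurable_coord_map: "coord_map n a \<in> measurable (lborel_coord n) (lborel_coord n)"
  unfolding coord_map_def by (intro measurable_restrict) measurable

lemma coord_map_inverse:
  assumes "\<And>i j. i < n \<Longrightarrow> j < n \<Longrightarrow> (\<Sum>k<n. a i k * b k j) = (if i = j then 1 else 0)"
    and "x \<in> space (lborel_coord n)"
  shows "coord_map n a (coord_map n b x) = x"
proof
  fix i
  show "coord_map n a (coord_map n b x) i = x i"
  proof (cases "i < n")
    case True
    have "coord_map n a (coord_map n b x) i = (\<Sum>k<n. \<Sum>j<n. a i k * b k j * x j)"
      using True by (simp add: coord_map_def sum_distrib_left mult.assoc)
    also have "\<dots> = (\<Sum>j<n. (\<Sum>k<n. a i k * b k j) * x j)"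
      by (subst sum.swap) (simp add: sum_distrib_right)
    also have "\<dots> = (\<Sum>j<n. if i = j then x j else 0)"
      using True assms(1) by (intro sum.cong) auto
    finally show ?thesis using True by simp
  next
    case False
    then show ?thesis
      using assms(2) by (auto simp: coord_map_def space_PiM PiE_def extensional_def)
  qed
qed

text \<open>
  An invertible linear map sends Borel sets to Borel sets and null sets to null sets, so the change of
  variables formula extends to Lebesgue measurable sets.
\<close>

lemma completion_coord_map_image:
  fixes a :: "nat \<Rightarrow> nat \<Rightarrow> real"
  assumes det: "fun_det n a \<noteq> 0" and A: "A \<in> sets (completion (lborel_coord n))"
  shows "coord_map n a ` A \<in> sets (completion (lborel_coord n))"
    and "emeasure (completion (lborel_coord n)) (coord_map n a ` A)
      = ennreal \<bar>fun_det n a\<bar> * emeasure (completion (lborel_coord n)) A"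
proof -
  let ?L = "lborel_coord n"
  let ?T = "coord_map n a"
  obtain b where b:
    "\<And>i j. i < n \<Longrightarrow> j < n \<Longrightarrow> (\<Sum>k<n. a i k * b k j) = (if i = j then 1 else 0)"
    "\<And>i j. i < n \<Longrightarrow> j < n \<Longrightarrow> (\<Sum>k<n. b i k * a k j) = (if i = j then 1 else 0)"
    by (rule fun_det_inverse[OF det]) blast
  let ?S = "coord_map n b"
  have TS: "?T (?S x) = x" and ST: "?S (?T x) = x" if "x \<in> space ?L" for x
    using that b by (auto intro: coord_map_inverse)
  have borel: "?T ` B \<in> sets ?L" "emeasure ?L (?T ` B) = ennreal \<bar>fun_det n a\<bar> * emeasure ?L B"
    if B: "B \<in> sets ?L" for B
  proof -
    have sub: "B \<subseteq> space ?L" using B by (rule sets.sets_into_space)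
    have "?T ` B = ?S -` B \<inter> space ?L"
    proof
      show "?T ` B \<subseteq> ?S -` B \<inter> space ?L"
      proof
        fix y assume "y \<in> ?T ` B"
        then obtain x where "x \<in> B" "y = ?T x" by blast
        then show "y \<in> ?S -` B \<inter> space ?L"
          using ST[of x] sub coord_map_space[of n a x] by (metis IntI subsetD vimageI)
      qed
      show "?S -` B \<inter> space ?L \<subseteq> ?T ` B"
      proof
        fix x assume "x \<in> ?S -` B \<inter> space ?L"
        then show "x \<in> ?T ` B" using TS[of x] by (metis Int_iff image_eqI vimage_eq)
      qed
    qed
    then show TB: "?T ` B \<in> sets ?L"
      using measurable_sets[OF measurable_coord_map B] by simp
    have "emeasure ?L (?T ` B) = (\<integral>\<^sup>+x. indicator (?T ` B) x \<partial>?L)"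
      using TB by simp
    also have "\<dots> = ennreal \<bar>fun_det n a\<bar> * (\<integral>\<^sup>+x. indicator (?T ` B) (?T x) \<partial>?L)"
      using nn_integral_lborel_coord_affine[OF det borel_measurable_indicator[OF TB], of "\<lambda>_. 0"]
      unfolding coord_map_def add_0 .
    also have "(\<integral>\<^sup>+x. indicator (?T ` B) (?T x) \<partial>?L) = (\<integral>\<^sup>+x. indicator B x \<partial>?L)"
    proof (rule nn_integral_cong)
      fix x assume x: "x \<in> space ?L"
      have "?T x \<in> ?T ` B \<longleftrightarrow> x \<in> B"
      proof
        assume "?T x \<in> ?T ` B"
        then obtain z where z: "z \<in> B" "?T x = ?T z" by blast
        then have "?S (?T x) = ?S (?T z)" by simp
        moreover have "z \<in> space ?L" using z(1) sub by blast
        ultimately have "x = z" using ST x by metis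
        then show "x \<in> B" using z(1) by simp
      qed (rule imageI)
      then show "indicator (?T ` B) (?T x) = (indicator B x :: ennreal)"
        by (simp add: indicator_def)
    qed
    finally show "emeasure ?L (?T ` B) = ennreal \<bar>fun_det n a\<bar> * emeasure ?L B" using B by simp
  qed
  obtain S N N' where A_eq: "A = S \<union> N" and N: "N \<subseteq> N'" "N' \<in> null_sets ?L" and S: "S \<in> sets ?L"
    using A by (rule sets_completionE)
  have null: "?T ` N' \<in> null_sets ?L"
  proof (rule null_setsI)
    have "N' \<in> sets ?L" "emeasure ?L N' = 0" using N(2) by auto
    then show "emeasure ?L (?T ` N') = 0" "?T ` N' \<in> sets ?L" using borel by simp_all
  qed
  have nullT: "?T ` N \<in> null_sets (completion ?L)"
    by (rule null_sets_completion_subset[OF image_mono[OF N(1)] null_sets_completionI[OF null]])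
  have nullN: "N \<in> null_sets (completion ?L)"
    by (rule null_sets_completion_subset[OF N(1) null_sets_completionI[OF N(2)]])
  have SC: "S \<in> sets (completion ?L)" "?T ` S \<in> sets (completion ?L)"
    using S borel(1)[OF S] by auto
  show "?T ` A \<in> sets (completion ?L)"
    unfolding A_eq image_Un using SC nullT by auto
  have "emeasure (completion ?L) (?T ` A) = emeasure (completion ?L) (?T ` S)"
    unfolding A_eq image_Un by (rule emeasure_Un_null_set[OF SC(2) nullT])
  also have "\<dots> = ennreal \<bar>fun_det n a\<bar> * emeasure (completion ?L) S"
    using borel[OF S] S by simp
  also have "emeasure (completion ?L) S = emeasure (completion ?L) A"
    unfolding A_eq by (rule emeasure_Un_null_set[OF SC(1) nullN, symmetric])
  finally show "emeasure (completion ?L) (?T ` A) = ennreal \<bar>fun_det n a\<bar> * emeasure (completion ?L) A" .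
qed

section \<open>Relations in exterior powers\<close>

lemma wedge_relations_uminus:
  assumes "x \<in> wedge_relations smul p"
  shows "- x \<in> wedge_relations smul p"
proof -
  have "Poly_Mapping.map ((*) (- 1)) x = - x"
    by (rule poly_mapping_eqI) (simp add: Poly_Mapping.map.rep_eq when_def)
  then show ?thesis using wedge_relations.smult[OF assms, of "- 1"] by simp
qed

lemma wedge_relations_diff:
  assumes "x \<in> wedge_relations smul p" "y \<in> wedge_relations smul p"
  shows "x - y \<in> wedge_relations smul p"
  using wedge_relations.add[OF assms(1) wedge_relations_uminus[OF assms(2)]] by simp

lemma wedge_relations_single_scale:
  assumes "Poly_Mapping.single vs 1 \<in> wedge_relations smul p"
  shows "Poly_Mapping.single vs c \<in> wedge_relations smul p"
  using wedge_relations.smult[OF assms, of c] by simp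

lemma pvector_eq_0:
  assumes "x \<in> wedge_relations smul p"
  shows "pvector smul p x = pvector smul p 0"
proof -
  have "y - x \<in> wedge_relations smul p \<longleftrightarrow> y \<in> wedge_relations smul p" for y
    using wedge_relations.add[OF _ assms, of "y - x"] wedge_relations_diff[OF _ assms, of y] by auto
  then show ?thesis by (simp add: pvector_def)
qed

lemma wedge_relations_repeated:
  assumes len: "length vs = p" and ij: "i < p" "j < p" "i \<noteq> j" and eq: "vs ! i = vs ! j"
  shows "Poly_Mapping.single vs 1 \<in> wedge_relations smul p"
  using ij eq
proof (induction i j rule: linorder_wlog)
  case (le i j)
  then have "i < j" by simp
  have "vs = take i vs @ vs ! i # drop (Suc i) vs"
    using le len by (intro id_take_nth_drop) simp
  moreover have "drop (Suc i) vs
      = take (j - Suc i) (drop (Suc i) vs) @ vs ! j # drop (Suc (j - Suc i)) (drop (Suc i) vs)"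
    using id_take_nth_drop[of "j - Suc i" "drop (Suc i) vs"] \<open>i < j\<close> le len by simp
  ultimately obtain us ws xs where vs: "vs = us @ vs ! i # ws @ vs ! i # xs"
    using le by metis
  show ?case
    by (subst vs, rule wedge_relations.alternating) (use vs len in metis)
next
  case (sym i j)
  then show ?case by metis
qed

text \<open>
  If \<open>v\<^sub>k\<close> is a linear combination of the other factors, then expanding slot \<open>k\<close> gives wedge products
  with a repeated factor only.
\<close>

lemma wedge_relations_dependent:
  assumes "vector_space smul" and len: "length vs = p" and k: "k < p" "y k \<noteq> 0"
    and dep: "(\<Sum>i<p. smul (y i) (vs ! i)) = 0"
  shows "Poly_Mapping.single vs 1 \<in> wedge_relations smul p"
proof -
  interpret vector_space smul by fact
  have slot: "Poly_Mapping.single (vs[k := \<Sum>i\<in>J. smul (z i) (vs ! i)]) 1 \<in> wedge_relations smul p"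
    if "finite J" "J \<subseteq> {..<p} - {k}" for J z
    using that
  proof (induction J)
    case empty
    have "Poly_Mapping.single (vs[k := smul 0 0]) 1 - Poly_Mapping.single (vs[k := 0]) 0
        \<in> wedge_relations smul p"
      using k len unfolding upd_conv_take_nth_drop[OF k(1)[folded len]]
      by (intro wedge_relations.slot_scale) auto
    then show ?case by simp
  next
    case (insert j J)
    let ?w = "\<Sum>i\<in>J. smul (z i) (vs ! i)"
    have "Poly_Mapping.single (vs[k := smul (z j) (vs ! j)]) 1 - Poly_Mapping.single (vs[k := vs ! j]) (z j)
        \<in> wedge_relations smul p"
      using k len unfolding upd_conv_take_nth_drop[OF k(1)[folded len]]
      by (intro wedge_relations.slot_scale) auto
    moreover have "Poly_Mapping.single (vs[k := vs ! j]) (z j) \<in> wedge_relations smul p"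
      by (rule wedge_relations_single_scale, rule wedge_relations_repeated[of _ p k j])
        (use insert.prems k len in auto)
    ultimately have j: "Poly_Mapping.single (vs[k := smul (z j) (vs ! j)]) 1 \<in> wedge_relations smul p"
      using wedge_relations.add by fastforce
    have "Poly_Mapping.single (vs[k := smul (z j) (vs ! j) + ?w]) 1
        - Poly_Mapping.single (vs[k := smul (z j) (vs ! j)]) 1 - Poly_Mapping.single (vs[k := ?w]) 1
        \<in> wedge_relations smul p"
      using k len unfolding upd_conv_take_nth_drop[OF k(1)[folded len]]
      by (intro wedge_relations.slot_add) auto
    from wedge_relations.add[OF wedge_relations.add[OF this insert.IH] j] insert.prems
    show ?case using insert.hyps by (simp add: algebra_simps)
  qed
  have "0 = smul (y k) (vs ! k) + (\<Sum>i\<in>{..<p} - {k}. smul (y i) (vs ! i))"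
    using dep k(1) by (simp add: sum.remove)
  then have "smul (y k) (vs ! k) = - (\<Sum>i\<in>{..<p} - {k}. smul (y i) (vs ! i))"
    by (simp add: eq_neg_iff_add_eq_0)
  then have "smul (inverse (y k)) (smul (y k) (vs ! k))
      = smul (inverse (y k)) (- (\<Sum>i\<in>{..<p} - {k}. smul (y i) (vs ! i)))" by simp
  then have "vs ! k = (\<Sum>i\<in>{..<p} - {k}. smul (- (inverse (y k) * y i)) (vs ! i))"
    using k(2) by (simp add: scale_sum_right sum_negf)
  then have "vs[k := \<Sum>i\<in>{..<p} - {k}. smul (- (inverse (y k) * y i)) (vs ! i)] = vs"
    by (metis list_update_id)
  then show ?thesis
    using slot[of "{..<p} - {k}" "\<lambda>i. - (inverse (y k) * y i)"] by simp
qed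

section \<open>Gram determinants of blades\<close>

text \<open>
  The common ground of the real case (\<open>cj\<close> the identity) and the complex case (\<open>cj\<close> the conjugation): a
  vector space with a form that is conjugate-linear in its first argument. In place of positivity,
  which makes no sense over an arbitrary field, every nonzero vector is required to have a multiple of
  unit length; this is what Gram-Schmidt orthogonalisation needs.
\<close>

locale hermitian_space = vector_space smul
  for smul :: "'k::field \<Rightarrow> 'a::ab_group_add \<Rightarrow> 'a" +
  fixes cj :: "'k \<Rightarrow> 'k" and ip :: "'a \<Rightarrow> 'a \<Rightarrow> 'k"
  assumes cj_hom: "comm_ring_hom cj"
    and cj_cj: "cj (cj c) = c"
    and ip_commute: "ip x y = cj (ip y x)"
    and ip_add_right: "ip x (y + z) = ip x y + ip x z"
    and ip_scale_right: "ip x (smul c y) = c * ip x y"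
    and normalizable: "x \<noteq> 0 \<Longrightarrow> \<exists>c. ip (smul c x) (smul c x) = 1"
begin

lemma cj_zero: "cj 0 = 0"
  and cj_add: "cj (c + d) = cj c + cj d"
  and cj_mult: "cj (c * d) = cj c * cj d"
  and cj_sum: "cj (sum f A) = (\<Sum>i\<in>A. cj (f i))"
proof -
  interpret comm_ring_hom cj by (rule cj_hom)
  show "cj 0 = 0" "cj (c + d) = cj c + cj d" "cj (c * d) = cj c * cj d" "cj (sum f A) = (\<Sum>i\<in>A. cj (f i))"
    by (rule hom_zero, rule hom_add, rule hom_mult, rule hom_sum)
qed

lemma ip_add_left: "ip (x + y) z = ip x z + ip y z"
  using ip_commute ip_add_right cj_add by metis

lemma ip_scale_left: "ip (smul c x) y = cj c * ip x y"
  using ip_commute ip_scale_right cj_mult by metis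

lemma ip_zero_right: "ip x 0 = 0"
  using ip_scale_right[of x 0 0] by simp

lemma ip_zero_left: "ip 0 x = 0"
  using ip_commute[of 0 x] by (simp add: ip_zero_right cj_zero)

lemma ip_sum_right: "ip x (sum f A) = (\<Sum>i\<in>A. ip x (f i))"
  by (induction A rule: infinite_finite_induct) (simp_all add: ip_zero_right ip_add_right)

lemma ip_sum_left: "ip (sum f A) x = (\<Sum>i\<in>A. ip (f i) x)"
  by (induction A rule: infinite_finite_induct) (simp_all add: ip_zero_left ip_add_left)

text \<open>
  The determinant of the inner products of the first \<open>p\<close> entries of two lists.
\<close>

definition gram_det :: "'a list \<Rightarrow> 'a list \<Rightarrow> nat \<Rightarrow> 'k" where
  "gram_det vs ws p = fun_det p (\<lambda>i j. ip (vs ! i) (ws ! j))"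

lemma gram_det_commute: "gram_det vs ws p = cj (gram_det ws vs p)"
proof -
  have "gram_det vs ws p = fun_det p (\<lambda>i j. cj (ip (ws ! j) (vs ! i)))"
    unfolding gram_det_def using ip_commute by (intro fun_det_cong) metis
  also have "\<dots> = cj (gram_det ws vs p)"
    unfolding fun_det_hom[OF cj_hom] gram_det_def
      fun_det_transpose[of p "\<lambda>i j. ip (ws ! i) (vs ! j)"] ..
  finally show ?thesis .
qed

lemma gram_form_supset:
  assumes "finite K" "finite L" "Poly_Mapping.keys x \<subseteq> K" "Poly_Mapping.keys y \<subseteq> L"
  shows "gram_form cj ip p x y
    = (\<Sum>vs\<in>K. \<Sum>ws\<in>L. cj (Poly_Mapping.lookup x vs) * Poly_Mapping.lookup y ws * gram_det vs ws p)"
proof -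
  let ?t = "\<lambda>vs ws. cj (Poly_Mapping.lookup x vs) * Poly_Mapping.lookup y ws * gram_det vs ws p"
  have "gram_form cj ip p x y = (\<Sum>vs\<in>Poly_Mapping.keys x. \<Sum>ws\<in>Poly_Mapping.keys y. ?t vs ws)"
    by (simp add: gram_form_def gram_det_def fun_det_def)
  also have "\<dots> = (\<Sum>vs\<in>Poly_Mapping.keys x. \<Sum>ws\<in>L. ?t vs ws)"
    by (intro sum.cong refl sum.mono_neutral_left assms) (simp add: in_keys_iff)
  also have "\<dots> = (\<Sum>vs\<in>K. \<Sum>ws\<in>L. ?t vs ws)"
    by (intro sum.mono_neutral_left assms ballI) (simp add: in_keys_iff cj_zero)
  finally show ?thesis .
qed

lemma gram_form_commute: "gram_form cj ip p x y = cj (gram_form cj ip p y x)"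
  unfolding gram_form_supset[OF finite_keys finite_keys order_refl order_refl]
  by (subst sum.swap) (simp add: cj_sum cj_mult cj_cj gram_det_commute[symmetric] mult_ac)

lemma gram_form_add_right: "gram_form cj ip p x (y + z) = gram_form cj ip p x y + gram_form cj ip p x z"
proof -
  let ?L = "Poly_Mapping.keys y \<union> Poly_Mapping.keys z"
  have "Poly_Mapping.keys (y + z) \<subseteq> ?L" by (rule Poly_Mapping.keys_add)
  then show ?thesis
    by (simp add: gram_form_supset[of "Poly_Mapping.keys x" ?L] Poly_Mapping.lookup_add
        algebra_simps sum.distrib)
qed

lemma gram_form_scale_right: "gram_form cj ip p x (Poly_Mapping.map ((*) c) y) = c * gram_form cj ip p x y"
proof -
  have "Poly_Mapping.keys (Poly_Mapping.map ((*) c) y) \<subseteq> Poly_Mapping.keys y"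
    by (auto simp: in_keys_iff Poly_Mapping.map.rep_eq when_def)
  moreover have "Poly_Mapping.lookup (Poly_Mapping.map ((*) c) y) ws = c * Poly_Mapping.lookup y ws" for ws
    by (simp add: Poly_Mapping.map.rep_eq when_def)
  ultimately show ?thesis
    by (simp add: gram_form_supset[of "Poly_Mapping.keys x" "Poly_Mapping.keys y"]
        sum_distrib_left mult_ac)
qed

lemma gram_form_zero_right: "gram_form cj ip p x 0 = 0"
  by (simp add: gram_form_def)

lemma gram_form_diff_right: "gram_form cj ip p x (y - z) = gram_form cj ip p x y - gram_form cj ip p x z"
  using gram_form_add_right[of p x "y - z" z] by simp

lemma gram_form_single_right:
  "gram_form cj ip p x (Poly_Mapping.single ws d)
    = (\<Sum>vs\<in>Poly_Mapping.keys x. cj (Poly_Mapping.lookup x vs) * d * gram_det vs ws p)"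
  by (subst gram_form_supset[of "Poly_Mapping.keys x" "{ws}"]) auto

lemma gram_form_single:
  "gram_form cj ip p (Poly_Mapping.single vs c) (Poly_Mapping.single ws d) = cj c * d * gram_det vs ws p"
  by (subst gram_form_supset[of "{vs}" "{ws}"]) auto

lemma gram_det_slot_linear:
  assumes "length (us @ v # ws) = p"
  shows "gram_det vs (us @ (smul c v + v') # ws) p
    = c * gram_det vs (us @ v # ws) p + gram_det vs (us @ v' # ws) p"
proof -
  let ?k = "length us"
  have slot: "gram_det vs (us @ u # ws) p
      = fun_det p (\<lambda>i j. if j = ?k then ip (vs ! i) u else ip (vs ! i) ((us @ v # ws) ! j))" for u
    unfolding gram_det_def by (rule fun_det_cong) (auto simp: nth_append nth_Cons')
  show ?thesis
    unfolding slot ip_add_right ip_scale_right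
    by (rule fun_det_column_linear) (use assms in auto)
qed

lemma gram_form_relation_right:
  assumes "r \<in> wedge_relations smul p"
  shows "gram_form cj ip p x r = 0"
  using assms
proof induction
  case zero
  then show ?case by (rule gram_form_zero_right)
next
  case (add r s)
  then show ?case by (simp add: gram_form_add_right)
next
  case (smult r c)
  then show ?case by (simp add: gram_form_scale_right)
next
  case (slot_add us v ws v')
  show ?case
    using gram_det_slot_linear[OF slot_add, of _ 1]
    by (simp add: gram_form_diff_right gram_form_single_right distrib_left sum.distrib)
next
  case (slot_scale us v ws c)
  have "gram_det vs (us @ 0 # ws) p = 0" for vs
    using gram_det_slot_linear[of us 0 ws p vs "- 1" 0] slot_scale by simp
  then show ?case
    using gram_det_slot_linear[OF slot_scale, of _ c 0]
    by (simp add: gram_form_diff_right gram_form_single_right mult.assoc)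
next
  case (alternating us v vs ws)
  have "gram_det as (us @ v # vs @ v # ws) p = 0" for as
    unfolding gram_det_def
    by (rule fun_det_identical_columns[of "length us" p "length us + Suc (length vs)"])
       (use alternating in \<open>auto simp: nth_append\<close>)
  then show ?case by (simp add: gram_form_single_right)
qed

text \<open>
  The Gram form does not depend on the representatives, so the unique common value that defines the
  inner product of \<open>p\<close>-vectors exists.
\<close>

lemma pvector_inner_pvector:
  "pvector_inner cj ip p (pvector smul p x) (pvector smul p y) = gram_form cj ip p x y"
  unfolding pvector_inner_def
proof (rule the_equality)
  have right: "gram_form cj ip p u y' = gram_form cj ip p u y" if "y' \<in> pvector smul p y" for u y y'
    using gram_form_relation_right[of "y' - y" p u] that
    by (simp add: pvector_def gram_form_diff_right)
  have "gram_form cj ip p x' y' = gram_form cj ip p x y"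
    if "x' \<in> pvector smul p x" "y' \<in> pvector smul p y" for x' y'
    using right[OF that(1), of y'] right[OF that(2), of x]
      gram_form_commute[of p x' y'] gram_form_commute[of p x y'] by simp
  then show "\<forall>x'\<in>pvector smul p x. \<forall>y'\<in>pvector smul p y. gram_form cj ip p x' y' = gram_form cj ip p x y"
    by blast
next
  fix c
  assume "\<forall>x'\<in>pvector smul p x. \<forall>y'\<in>pvector smul p y. gram_form cj ip p x' y' = c"
  moreover have "u \<in> pvector smul p u" for u
    by (simp add: pvector_def wedge_relations.zero)
  ultimately show "c = gram_form cj ip p x y" by metis
qed

text \<open>
  Orthonormality with respect to \<open>ip\<close>; the positions matter, so the entries are automatically
  distinct.
\<close>

definition orthonormal_list :: "'a list \<Rightarrow> bool" where
  "orthonormal_list es \<longleftrightarrow>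
    (\<forall>i<length es. \<forall>j<length es. ip (es ! i) (es ! j) = (if i = j then 1 else 0))"

lemma orthonormal_list_expand:
  assumes on: "orthonormal_list es" and v: "v \<in> span (set es)"
  shows "v = (\<Sum>j<length es. smul (ip (es ! j) v) (es ! j))"
  using v
proof (induction rule: span_induct_alt)
  case base
  then show ?case by (simp add: ip_zero_right)
next
  case (step c b y)
  obtain k where k: "k < length es" "b = es ! k" using step.hyps(1) by (metis in_set_conv_nth)
  have "(\<Sum>j<length es. smul (ip (es ! j) b) (es ! j)) = (\<Sum>j<length es. if j = k then b else 0)"
    using on k by (intro sum.cong) (auto simp: orthonormal_list_def)
  then have "(\<Sum>j<length es. smul (ip (es ! j) b) (es ! j)) = b" using k by simp
  then have "smul c b = (\<Sum>j<length es. smul (c * ip (es ! j) b) (es ! j))"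
    by (metis (no_types, lifting) scale_scale scale_sum_right sum.cong)
  moreover have "(\<Sum>j<length es. smul (ip (es ! j) (smul c b + y)) (es ! j))
      = (\<Sum>j<length es. smul (c * ip (es ! j) b) (es ! j)) + (\<Sum>j<length es. smul (ip (es ! j) y) (es ! j))"
    by (simp add: ip_add_right ip_scale_right scale_left_distrib sum.distrib)
  ultimately show ?case using step.IH by metis
qed

lemma orthonormal_list_parseval:
  assumes "orthonormal_list es" "v \<in> span (set es)"
  shows "ip v y = (\<Sum>k<length es. ip v (es ! k) * ip (es ! k) y)"
proof -
  have "ip v y = ip (\<Sum>j<length es. smul (ip (es ! j) v) (es ! j)) y"
    using orthonormal_list_expand[OF assms] by simp
  also have "\<dots> = (\<Sum>k<length es. cj (ip (es ! k) v) * ip (es ! k) y)"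
    by (simp add: ip_sum_left ip_scale_left)
  finally show ?thesis by (simp add: ip_commute[symmetric])
qed

lemma orthonormal_list_dim:
  assumes "orthonormal_list es"
  shows "dim (span (set es)) = length es"
proof -
  have on: "ip (es ! i) (es ! j) = (if i = j then 1 else 0)" if "i < length es" "j < length es" for i j
    using assms that by (auto simp: orthonormal_list_def)
  have dist: "distinct es"
    unfolding distinct_conv_nth using on by (metis zero_neq_one)
  have "independent (set es)"
  proof
    assume "dependent (set es)"
    then obtain u v where v: "v \<in> set es" "u v \<noteq> 0" and sum: "(\<Sum>w\<in>set es. smul (u w) w) = 0"
      unfolding dependent_finite[OF finite_set] by blast
    have "ip v (\<Sum>w\<in>set es. smul (u w) w) = (\<Sum>w\<in>set es. if w = v then u v else 0)"
      unfolding ip_sum_right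
    proof (rule sum.cong)
      fix w assume "w \<in> set es"
      then show "ip v (smul (u w) w) = (if w = v then u v else 0)"
        using on v(1) unfolding ip_scale_right in_set_conv_nth by (metis mult.right_neutral mult_zero_right)
    qed simp
    then show False using v sum by (simp add: ip_zero_right)
  qed
  then show ?thesis
    using dim_span_eq_card_independent distinct_card[OF dist] by metis
qed

text \<open>
  Gram-Schmidt orthogonalisation.
\<close>

lemma orthonormal_list_exists:
  assumes "finite B"
  shows "\<exists>es. orthonormal_list es \<and> span (set es) = span B"
  using assms
proof (induction B)
  case empty
  then show ?case by (intro exI[of _ "[]"]) (simp add: orthonormal_list_def)
next
  case (insert b B)
  then obtain es where es: "orthonormal_list es" "span (set es) = span B" by blast
  define q where "q = (\<Sum>j<length es. smul (ip (es ! j) b) (es ! j))"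
  have q: "q \<in> span (set es)"
    unfolding q_def by (intro span_sum span_scale span_base) auto
  have sp: "span (insert x (set es)) = span (insert x B)" for x
    by (simp add: span_insert es(2))
  show ?case
  proof (cases "b = q")
    case True
    then have "span (insert b B) = span B" using q es(2) by (simp add: span_redundant)
    then show ?thesis using es by metis
  next
    case False
    then obtain c where c: "ip (smul c (b - q)) (smul c (b - q)) = 1"
      using normalizable[of "b - q"] by auto
    let ?e = "smul c (b - q)"
    \<comment> \<open>The component \<open>q\<close> of \<open>b\<close> along \<open>es\<close> has been removed and the rest normalised to \<open>?e\<close>.\<close>
    have c0: "c \<noteq> 0" using c by (auto simp: ip_zero_left)
    have "ip (es ! i) q = ip (es ! i) b" if "i < length es" for i
    proof -
      have "ip (es ! i) q = (\<Sum>j<length es. if j = i then ip (es ! j) b else 0)"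
        unfolding q_def ip_sum_right ip_scale_right
        using es(1) that by (intro sum.cong) (auto simp: orthonormal_list_def)
      then show ?thesis using that by simp
    qed
    then have 0: "ip (es ! i) ?e = 0" "ip ?e (es ! i) = 0" if "i < length es" for i
      using ip_add_right[of "es ! i" "b - q" q] that ip_commute[of ?e "es ! i"]
      by (simp_all add: ip_scale_right cj_zero)
    have "orthonormal_list (es @ [?e])"
      using es(1) c 0 by (auto simp: orthonormal_list_def nth_append less_Suc_eq)
    moreover have "span (insert ?e (set es)) = span (insert b (set es))"
      unfolding span_eq
    proof (intro conjI insert_subsetI)
      show "?e \<in> span (insert b (set es))"
        using q by (intro span_scale span_diff) (auto intro: span_base span_mono[THEN subsetD, of "set es"])
      have "?e \<in> span (insert ?e (set es))" by (rule span_base) simp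
      moreover have "q \<in> span (insert ?e (set es))"
        using q span_mono[of "set es" "insert ?e (set es)"] by blast
      ultimately have "smul (inverse c) ?e + q \<in> span (insert ?e (set es))"
        by (rule span_add[OF span_scale])
      then show "b \<in> span (insert ?e (set es))" using c0 by simp
    qed (auto intro: span_base)
    ultimately show ?thesis by (intro exI[of _ "es @ [?e]"]) (simp add: sp)
  qed
qed

lemma orthonormal_basis_exists:
  assumes "finite B" "span B = UNIV" "subspace U"
  obtains es where "orthonormal_list es" "span (set es) = U" "length es = dim U"
proof -
  obtain C where C: "C \<subseteq> U" "independent C" "U \<subseteq> span C"
    using basis_exists by metis
  have "finite C"
    using independent_span_bound[OF assms(1) C(2)] assms(2) by simp
  then obtain es where es: "orthonormal_list es" "span (set es) = span C"
    using orthonormal_list_exists by blast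
  have "span C = U" using C assms(3) by (metis span_minimal subset_antisym)
  then show ?thesis using that es orthonormal_list_dim by metis
qed

lemma gram_det_factor:
  assumes es: "orthonormal_list es" "length es = p" and vs: "length vs = p" "set vs \<subseteq> span (set es)"
  shows "gram_det vs ws p = gram_det vs es p * gram_det es ws p"
proof -
  have "gram_det vs ws p = fun_det p (\<lambda>i j. \<Sum>k<p. ip (vs ! i) (es ! k) * ip (es ! k) (ws ! j))"
    unfolding gram_det_def
  proof (rule fun_det_cong)
    fix i j assume "i < p"
    then have "vs ! i \<in> span (set es)" using vs by (metis nth_mem subsetD)
    then show "ip (vs ! i) (ws ! j) = (\<Sum>k<p. ip (vs ! i) (es ! k) * ip (es ! k) (ws ! j))"
      using orthonormal_list_parseval[OF es(1)] es(2) by simp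
  qed
  then show ?thesis unfolding gram_det_def by (simp add: fun_det_mult)
qed

text \<open>
  A kernel vector of the coordinate matrix of \<open>vs\<close> gives a linear combination of \<open>vs\<close> all of whose
  coordinates vanish, that is, a linear dependence.
\<close>

lemma wedge_relations_if_gram_det_eq_0:
  assumes es: "orthonormal_list es" "length es = p" and vs: "length vs = p" "set vs \<subseteq> span (set es)"
    and det: "gram_det es vs p = 0"
  shows "Poly_Mapping.single vs 1 \<in> wedge_relations smul p"
proof -
  obtain y k where y: "k < p" "y k \<noteq> 0" "\<And>i. i < p \<Longrightarrow> (\<Sum>j<p. ip (es ! i) (vs ! j) * y j) = 0"
    using fun_det_eq_0_kernel[OF det[unfolded gram_det_def]] by metis
  let ?w = "\<Sum>j<p. smul (y j) (vs ! j)"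
  have "vs ! j \<in> span (set es)" if "j < p" for j
    using that vs by (metis nth_mem subsetD)
  then have "?w \<in> span (set es)" by (intro span_sum span_scale) auto
  from orthonormal_list_expand[OF es(1) this]
  have "?w = (\<Sum>i<p. smul (ip (es ! i) ?w) (es ! i))" unfolding es(2) .
  also have "\<dots> = 0"
  proof (rule sum.neutral, rule ballI)
    fix i assume "i \<in> {..<p}"
    then have "ip (es ! i) ?w = 0"
      using y(3)[of i] by (simp add: ip_sum_right ip_scale_right mult.commute)
    then show "smul (ip (es ! i) ?w) (es ! i) = 0" by simp
  qed
  finally show ?thesis
    by (rule wedge_relations_dependent[of smul vs p k y, OF vector_space_axioms vs(1) y(1,2)])
qed

lemma nonzero_blade_cases:
  assumes es: "orthonormal_list es" "length es = p"
    and \<nu>: "\<nu> \<in> blades smul p (span (set es))" "\<nu> \<noteq> pvector smul p 0"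
  obtains vs c where "\<nu> = pvector smul p (Poly_Mapping.single vs c)" "length vs = p"
    "set vs \<subseteq> span (set es)" "c \<noteq> 0" "gram_det es vs p \<noteq> 0"
proof -
  obtain vs c where vs: "\<nu> = pvector smul p (Poly_Mapping.single vs c)" "length vs = p"
    "set vs \<subseteq> span (set es)"
    using \<nu>(1) unfolding blades_def by blast
  have "c \<noteq> 0" using vs(1) \<nu>(2) by auto
  moreover have "gram_det es vs p \<noteq> 0"
    using wedge_relations_if_gram_det_eq_0[OF es vs(2,3)] wedge_relations_single_scale
      pvector_eq_0 vs(1) \<nu>(2) by metis
  ultimately show ?thesis using that vs by blast
qed

text \<open>
  Here \<open>a\<close> and \<open>b\<close> are the coefficients of \<open>\<nu>\<close> and \<open>\<omega>\<close> with respect to the blades of the two orthonormal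
  bases.
\<close>

lemma blade_inner_factor:
  assumes es: "orthonormal_list es" "length es = p" and fs: "orthonormal_list fs" "length fs = p"
    and \<nu>: "\<nu> \<in> blades smul p (span (set es))" "\<nu> \<noteq> pvector smul p 0"
    and \<omega>: "\<omega> \<in> blades smul p (span (set fs))" "\<omega> \<noteq> pvector smul p 0"
  obtains a b where "a \<noteq> 0" "b \<noteq> 0"
    "pvector_inner cj ip p \<nu> \<omega> = cj a * b * gram_det es fs p"
    "pvector_inner cj ip p \<nu> \<nu> = cj a * a" "pvector_inner cj ip p \<omega> \<omega> = cj b * b"
proof -
  obtain vs c where vs: "\<nu> = pvector smul p (Poly_Mapping.single vs c)" "length vs = p"
    "set vs \<subseteq> span (set es)" "c \<noteq> 0" "gram_det es vs p \<noteq> 0"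
    using nonzero_blade_cases[OF es \<nu>] by metis
  obtain ws d where ws: "\<omega> = pvector smul p (Poly_Mapping.single ws d)" "length ws = p"
    "set ws \<subseteq> span (set fs)" "d \<noteq> 0" "gram_det fs ws p \<noteq> 0"
    using nonzero_blade_cases[OF fs \<omega>] by metis
  have right: "gram_det us ws p = gram_det us fs p * gram_det fs ws p" for us
    using gram_det_factor[OF fs ws(2,3), of us] gram_det_commute[of us ws p]
      gram_det_commute[of us fs p] gram_det_commute[of fs ws p]
    by (simp add: cj_mult mult.commute)
  show ?thesis
  proof (rule that[of "c * gram_det es vs p" "d * gram_det fs ws p"])
    show "pvector_inner cj ip p \<nu> \<omega> = cj (c * gram_det es vs p) * (d * gram_det fs ws p) * gram_det es fs p"
      unfolding vs(1) ws(1) pvector_inner_pvector gram_form_single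
        gram_det_factor[OF es vs(2,3), of ws] right[of es] gram_det_commute[of vs es]
      by (simp add: cj_mult mult_ac)
    show "pvector_inner cj ip p \<nu> \<nu> = cj (c * gram_det es vs p) * (c * gram_det es vs p)"
      unfolding vs(1) pvector_inner_pvector gram_form_single
        gram_det_factor[OF es vs(2,3), of vs] gram_det_commute[of vs es]
      by (simp add: cj_mult mult_ac)
    show "pvector_inner cj ip p \<omega> \<omega> = cj (d * gram_det fs ws p) * (d * gram_det fs ws p)"
      unfolding ws(1) pvector_inner_pvector gram_form_single
        gram_det_factor[OF fs ws(2,3), of ws] gram_det_commute[of ws fs]
      by (simp add: cj_mult mult_ac)
  qed (use vs ws in auto)
qed

end

section \<open>The projection factor as a determinant\<close>

interpretation real_hermitian: hermitian_space "scaleR :: real \<Rightarrow> 'a::real_inner \<Rightarrow> 'a" "\<lambda>r. r" inner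
  rewrites "module.span (scaleR :: real \<Rightarrow> 'a \<Rightarrow> 'a) = span"
    and "module.subspace (scaleR :: real \<Rightarrow> 'a \<Rightarrow> 'a) = subspace"
    and "vector_space.dim (scaleR :: real \<Rightarrow> 'a \<Rightarrow> 'a) = dim"
proof -
  show "hermitian_space (scaleR :: real \<Rightarrow> 'a \<Rightarrow> 'a) (\<lambda>r. r) inner"
  proof unfold_locales
    fix x :: 'a assume "x \<noteq> 0"
    then have "inner ((1 / norm x) *\<^sub>R x) ((1 / norm x) *\<^sub>R x) = 1"
      by (simp add: dot_square_norm power2_eq_square)
    then show "\<exists>c. inner (c *\<^sub>R x) (c *\<^sub>R x) = 1" by blast
  qed (auto simp: inner_add_right intro: inner_commute)
qed (simp_all add: span_raw_def subspace_raw_def dim_raw_def)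

lemma orthonormal_basis_of_iff:
  "orthonormal_basis_of bs U \<longleftrightarrow> real_hermitian.orthonormal_list bs \<and> span (set bs) = U"
  by (auto simp: orthonormal_basis_of_def real_hermitian.orthonormal_list_def)

text \<open>
  The linear combination of a list of vectors with given coefficients. For an orthonormal basis of a
  subspace it is the isometry from \<open>\<real>\<^sup>n\<close> along which Lebesgue measure is transported.
\<close>

definition lincomb_list :: "'a::real_vector list \<Rightarrow> (nat \<Rightarrow> real) \<Rightarrow> 'a" where
  "lincomb_list bs x = (\<Sum>i<length bs. x i *\<^sub>R (bs ! i))"

lemma inner_lincomb_list:
  assumes "orthonormal_basis_of bs U" "j < length bs"
  shows "inner (bs ! j) (lincomb_list bs x) = x j"
proof -
  have "inner (bs ! j) (lincomb_list bs x) = (\<Sum>i<length bs. if i = j then x i else 0)"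
    unfolding lincomb_list_def inner_sum_right
    using assms by (intro sum.cong) (auto simp: orthonormal_basis_of_def)
  then show ?thesis using assms(2) by simp
qed

lemma orthonormal_basis_of_expand:
  assumes "orthonormal_basis_of bs U" "v \<in> U"
  shows "v = lincomb_list bs (\<lambda>j. inner (bs ! j) v)"
  using assms real_hermitian.orthonormal_list_expand[of bs v]
  unfolding orthonormal_basis_of_iff lincomb_list_def by blast

lemma orthonormal_basis_of_parseval:
  assumes "orthonormal_basis_of bs U" "v \<in> U"
  shows "inner v y = (\<Sum>k<length bs. inner v (bs ! k) * inner (bs ! k) y)"
  using assms real_hermitian.orthonormal_list_parseval[of bs v]
  unfolding orthonormal_basis_of_iff by blast

lemma orthonormal_basis_of_nth_mem:
  assumes "orthonormal_basis_of bs U" "i < length bs"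
  shows "bs ! i \<in> U"
  using assms by (auto simp: orthonormal_basis_of_def intro: span_base)

lemma orthonormal_basis_of_dim:
  assumes "orthonormal_basis_of bs U"
  shows "dim U = length bs"
  using assms real_hermitian.orthonormal_list_dim[of bs]
  unfolding orthonormal_basis_of_iff by blast

lemma lincomb_list_inj_on:
  assumes "orthonormal_basis_of bs U"
  shows "inj_on (lincomb_list bs) (space (lborel_coord (length bs)))"
proof (rule inj_onI)
  fix x y
  assume xy: "x \<in> space (lborel_coord (length bs))" "y \<in> space (lborel_coord (length bs))"
    and eq: "lincomb_list bs x = lincomb_list bs y"
  have "x i = y i" if "i < length bs" for i
    using inner_lincomb_list[OF assms that] eq by metis
  then show "x = y"
    using xy by (intro PiE_ext[of x "{..<length bs}" "\<lambda>_. UNIV"]) (auto simp: space_PiM)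
qed

lemma lincomb_list_cong:
  "(\<And>i. i < length bs \<Longrightarrow> x i = y i) \<Longrightarrow> lincomb_list bs x = lincomb_list bs y"
  unfolding lincomb_list_def by (rule sum.cong) auto

lemma lincomb_list_mem:
  assumes "orthonormal_basis_of bs U"
  shows "lincomb_list bs x \<in> U"
proof -
  have "lincomb_list bs x \<in> span (set bs)"
    unfolding lincomb_list_def by (intro span_sum span_scale span_base) auto
  then show ?thesis using assms by (simp add: orthonormal_basis_of_def)
qed

lemma lincomb_list_image:
  assumes "orthonormal_basis_of bs U"
  shows "lincomb_list bs ` space (lborel_coord (length bs)) = U"
proof
  show "U \<subseteq> lincomb_list bs ` space (lborel_coord (length bs))"
  proof
    fix v assume "v \<in> U"
    then have "v = lincomb_list bs (\<lambda>j. inner (bs ! j) v)"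
      by (rule orthonormal_basis_of_expand[OF assms])
    also have "\<dots> = lincomb_list bs (\<lambda>j\<in>{..<length bs}. inner (bs ! j) v)"
      by (rule lincomb_list_cong) simp
    finally show "v \<in> lincomb_list bs ` space (lborel_coord (length bs))"
      by (auto simp: space_PiM intro!: image_eqI)
  qed
qed (use lincomb_list_mem[OF assms] in auto)

lemma orth_proj_eq_lincomb_list:
  assumes bs: "orthonormal_basis_of bs W"
  shows "orth_proj W x = lincomb_list bs (\<lambda>j. inner (bs ! j) x)"
  unfolding orth_proj_def
proof (rule the_equality)
  let ?w = "lincomb_list bs (\<lambda>j. inner (bs ! j) x)"
  have "inner (x - ?w) u = 0" if "u \<in> W" for u
  proof -
    have "inner (x - ?w) (bs ! j) = 0" if "j < length bs" for j
      using inner_lincomb_list[OF bs that, of "\<lambda>j. inner (bs ! j) x"]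
      by (simp add: inner_diff_left inner_diff_right inner_commute[of _ "bs ! j"])
    then show ?thesis
      using orthonormal_basis_of_parseval[OF bs that, of "x - ?w"]
      by (simp add: inner_commute)
  qed
  then show w: "?w \<in> W \<and> (\<forall>u\<in>W. inner (x - ?w) u = 0)"
    using lincomb_list_mem[OF bs] by blast
  fix w assume w': "w \<in> W \<and> (\<forall>u\<in>W. inner (x - w) u = 0)"
  have "subspace W" using bs by (auto simp: orthonormal_basis_of_def)
  then have "w - ?w \<in> W" using w w' by (simp add: subspace_diff)
  then have "inner (x - ?w) (w - ?w) - inner (x - w) (w - ?w) = 0" using w w' by simp
  then have "inner (w - ?w) (w - ?w) = 0" by (simp add: inner_diff_left)
  then show "w = ?w" by simp
qed

lemma orth_proj_lincomb_list:
  assumes "orthonormal_basis_of es V" "orthonormal_basis_of fs W"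
    and "length es = n" "length fs = n"
  shows "orth_proj W (lincomb_list es x)
    = lincomb_list fs (coord_map n (\<lambda>i j. inner (fs ! i) (es ! j)) x)"
  unfolding orth_proj_eq_lincomb_list[OF assms(2)]
  by (rule lincomb_list_cong)
     (simp add: assms coord_map_def lincomb_list_def inner_sum_right mult.commute)

text \<open>
  The basis chosen in the definition of Lebesgue measure on a subspace is orthonormal as soon as some
  orthonormal basis exists.
\<close>

lemma lebesgue_subspace_basis:
  assumes "orthonormal_basis_of bs U"
  obtains bs' where "orthonormal_basis_of bs' U" "length bs' = length bs"
    "lebesgue_subspace U
      = embed_measure (completion (lborel_coord (length bs))) (lincomb_list bs')"
proof -
  let ?b = "SOME bs. orthonormal_basis_of bs U"
  have b: "orthonormal_basis_of ?b U" using assms by (rule someI)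
  have len: "length ?b = length bs"
    using orthonormal_basis_of_dim[OF b] orthonormal_basis_of_dim[OF assms] by simp
  show ?thesis
  proof (rule that[OF b len])
    have "lincomb_list ?b = (\<lambda>x. \<Sum>i<length ?b. x i *\<^sub>R (?b ! i))"
      by (simp add: fun_eq_iff lincomb_list_def)
    then show "lebesgue_subspace U
        = embed_measure (completion (lborel_coord (length bs))) (lincomb_list ?b)"
      by (simp add: lebesgue_subspace_def Let_def len)
  qed
qed

text \<open>
  If the Gram matrix is singular, a kernel vector gives a nonzero \<open>w \<in> W\<close> orthogonal to \<open>V\<close>, hence to the
  projection of \<open>V\<close>. A basis of the projection together with \<open>w\<close> is then an independent subset of \<open>W\<close>.
\<close>

lemma dim_orth_proj_less:
  assumes es: "orthonormal_basis_of es V" and fs: "orthonormal_basis_of fs W"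
    and len: "length es = n" "length fs = n"
    and det: "fun_det n (\<lambda>i j. inner (es ! i) (fs ! j)) = 0"
  shows "dim (orth_proj W ` V) < n"
proof -
  obtain y k where y: "k < n" "y k \<noteq> 0" "\<And>i. i < n \<Longrightarrow> (\<Sum>j<n. inner (es ! i) (fs ! j) * y j) = 0"
    using fun_det_eq_0_kernel[OF det] by metis
  define w where "w = lincomb_list fs y"
  have w: "w \<in> W" "w \<noteq> 0"
    using lincomb_list_mem[OF fs] inner_lincomb_list[OF fs, of k y] y len by (auto simp: w_def)
  have e: "inner (es ! i) w = 0" if "i < n" for i
    using y(3)[OF that] by (simp add: w_def lincomb_list_def inner_sum_right len mult.commute)
  have "inner w v = 0" if "v \<in> V" for v
    using orthonormal_basis_of_parseval[OF es that, of w] e len by (simp add: inner_commute)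
  moreover have "inner (v - orth_proj W v) w = 0" for v
  proof -
    have "inner w (orth_proj W v) = (\<Sum>k<n. inner w (fs ! k) * inner (fs ! k) v)"
      by (simp add: orth_proj_eq_lincomb_list[OF fs] lincomb_list_def inner_sum_right len mult.commute)
    also have "\<dots> = inner w v" using orthonormal_basis_of_parseval[OF fs w(1), of v] len by simp
    finally show ?thesis by (simp add: inner_diff_right inner_commute[of _ w])
  qed
  ultimately have perp: "real_inner_class.orthogonal w u" if "u \<in> orth_proj W ` V" for u
    using that by (auto simp: real_inner_class.orthogonal_def inner_diff_right inner_commute[of _ w])
  obtain B where B: "B \<subseteq> orth_proj W ` V" "independent B" "card B = dim (orth_proj W ` V)"
    using basis_exists by metis
  have "B \<subseteq> W"
    using B(1) lincomb_list_mem[OF fs] by (auto simp: orth_proj_eq_lincomb_list[OF fs])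
  have "w \<notin> span B"
  proof
    assume "w \<in> span B"
    then have "real_inner_class.orthogonal w w" using perp B(1) by (intro orthogonal_to_span[of w B w]) auto
    then show False using w(2) by (simp add: real_inner_class.orthogonal_def)
  qed
  then have "independent (insert w B)" and wB: "w \<notin> B"
    using B(2) by (simp_all add: independent_insert) (meson span_base)
  moreover have "insert w B \<subseteq> span (set fs)"
    using w(1) \<open>B \<subseteq> W\<close> fs by (auto simp: orthonormal_basis_of_def)
  ultimately have fin: "finite (insert w B) \<and> card (insert w B) \<le> card (set fs)"
    by (intro independent_span_bound) auto
  then have "card (insert w B) = Suc (card B)" using wB by simp
  moreover have "card (set fs) \<le> n" using len card_length[of fs] by simp
  ultimately show ?thesis using fin B(3) by linarith
qed

text \<open>
  The set \<open>S\<close> of nonzero finite measure is what makes the ratio unique; without it, the defining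
  condition would hold vacuously for every \<open>c \<ge> 0\<close>.
\<close>

lemma projection_factor_eqI:
  assumes S: "S \<in> sets (lebesgue_subspace V)" "subspace_vol (dim V) V S \<noteq> 0" "subspace_vol (dim V) V S \<noteq> \<infinity>"
    and c: "0 \<le> c"
    and ratio: "\<And>S. S \<in> sets (lebesgue_subspace V) \<Longrightarrow> subspace_vol (dim V) V S \<noteq> 0 \<Longrightarrow>
      subspace_vol (dim V) V S \<noteq> \<infinity> \<Longrightarrow>
      subspace_vol (dim V) (orth_proj W ` V) (orth_proj W ` S) = ennreal c * subspace_vol (dim V) V S"
  shows "projection_factor V W = c"
  unfolding projection_factor_def
proof (rule the_equality)
  have div: "subspace_vol (dim V) (orth_proj W ` V) (orth_proj W ` S) / subspace_vol (dim V) V S = ennreal c"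
    if "S \<in> sets (lebesgue_subspace V)" "subspace_vol (dim V) V S \<noteq> 0"
      "subspace_vol (dim V) V S \<noteq> \<infinity>" for S
    unfolding ratio[OF that] using that by (intro ennreal_mult_divide_eq) auto
  then show "0 \<le> c \<and> (\<forall>S\<in>sets (lebesgue_subspace V).
           subspace_vol (dim V) V S \<noteq> 0 \<longrightarrow> subspace_vol (dim V) V S \<noteq> \<infinity> \<longrightarrow>
             subspace_vol (dim V) (orth_proj W ` V) (orth_proj W ` S) / subspace_vol (dim V) V S
               = ennreal c)"
    using c by blast
  fix c' assume c': "0 \<le> c' \<and> (\<forall>S\<in>sets (lebesgue_subspace V).
           subspace_vol (dim V) V S \<noteq> 0 \<longrightarrow> subspace_vol (dim V) V S \<noteq> \<infinity> \<longrightarrow>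
             subspace_vol (dim V) (orth_proj W ` V) (orth_proj W ` S) / subspace_vol (dim V) V S
               = ennreal c')"
  then have "ennreal c' = ennreal c" using div[OF S] S by metis
  then show "c' = c" using c c' by (simp add: ennreal_inj)
qed

text \<open>
  The formula is first obtained for the bases \<open>bs\<close> and \<open>cs\<close> that underlie the two measures. Passing to
  other orthonormal bases multiplies the Gram matrix by orthogonal matrices, whose determinants are
  \<open>1\<close> or \<open>-1\<close>.
\<close>

lemma projection_factor_eq_abs_det:
  assumes es: "orthonormal_basis_of es V" and fs: "orthonormal_basis_of fs W"
    and len: "length es = n" "length fs = n"
  shows "projection_factor V W = \<bar>fun_det n (\<lambda>i j. inner (es ! i) (fs ! j))\<bar>"
proof -
  let ?C = "completion (lborel_coord n)"
  obtain bs where bs: "orthonormal_basis_of bs V" "length bs = n"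
    and leb_V: "lebesgue_subspace V = embed_measure ?C (lincomb_list bs)"
    using lebesgue_subspace_basis[OF es] len by metis
  obtain cs where cs: "orthonormal_basis_of cs W" "length cs = n"
    and leb_W: "lebesgue_subspace W = embed_measure ?C (lincomb_list cs)"
    using lebesgue_subspace_basis[OF fs] len by metis
  define g where "g = (\<lambda>i j. inner (bs ! i) (cs ! j))"
  have dimV: "dim V = n" and dimW: "dim W = n"
    using orthonormal_basis_of_dim[OF bs(1)] orthonormal_basis_of_dim[OF cs(1)] bs(2) cs(2) by auto
  have injV: "inj_on (lincomb_list bs) (space ?C)" and injW: "inj_on (lincomb_list cs) (space ?C)"
    using lincomb_list_inj_on[OF bs(1)] lincomb_list_inj_on[OF cs(1)] bs(2) cs(2) by auto
  have vol_V: "subspace_vol n V (lincomb_list bs ` A) = emeasure ?C A" if "A \<in> sets ?C" for A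
    using emeasure_embed_measure_image'[OF injV that] by (simp add: subspace_vol_def dimV leb_V)
  have vol_W: "subspace_vol n W (lincomb_list cs ` A) = emeasure ?C A" if "A \<in> sets ?C" for A
    using emeasure_embed_measure_image'[OF injW that] by (simp add: subspace_vol_def dimW leb_W)
  have sets_V: "sets (lebesgue_subspace V) = {lincomb_list bs ` A |A. A \<in> sets ?C}"
    unfolding leb_V by (rule sets_embed_measure'[OF injV])
  have proj: "orth_proj W (lincomb_list bs x) = lincomb_list cs (coord_map n (\<lambda>i j. g j i) x)" for x
    unfolding orth_proj_lincomb_list[OF bs(1) cs(1) bs(2) cs(2)] by (simp add: g_def inner_commute)
  \<comment> \<open>The unit cube, a set of measure one.\<close>
  define Q where "Q = (\<Pi>\<^sub>E i\<in>{..<n}. {0..1::real})"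
  have Q: "Q \<in> sets (lborel_coord n)" unfolding Q_def by (rule sets_PiM_I_finite) auto
  have "emeasure (lborel_coord n) Q = 1"
    unfolding Q_def by (subst lborel_product.emeasure_PiM) auto
  then have volQ: "subspace_vol n V (lincomb_list bs ` Q) = 1"
    using Q by (subst vol_V) auto
  have "projection_factor V W = \<bar>fun_det n g\<bar>"
  proof (rule projection_factor_eqI[of "lincomb_list bs ` Q"], unfold dimV)
    show "lincomb_list bs ` Q \<in> sets (lebesgue_subspace V)" unfolding sets_V using Q by auto
    show "subspace_vol n V (lincomb_list bs ` Q) \<noteq> 0" "subspace_vol n V (lincomb_list bs ` Q) \<noteq> \<infinity>"
      using volQ by auto
    show "0 \<le> \<bar>fun_det n g\<bar>" by simp
    fix S assume "S \<in> sets (lebesgue_subspace V)"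
    then obtain A where A: "A \<in> sets ?C" "S = lincomb_list bs ` A" unfolding sets_V by blast
    show "subspace_vol n (orth_proj W ` V) (orth_proj W ` S) = ennreal \<bar>fun_det n g\<bar> * subspace_vol n V S"
    proof (cases "fun_det n g = 0")
      case True
      \<comment> \<open>The \<open>n\<close>-dimensional measure of a space of smaller dimension is zero by convention.\<close>
      then have "dim (orth_proj W ` V) < n"
        unfolding g_def by (rule dim_orth_proj_less[OF bs(1) cs(1) bs(2) cs(2)])
      then show ?thesis using True by (simp add: subspace_vol_def)
    next
      case False
      then have det: "fun_det n (\<lambda>i j. g j i) \<noteq> 0" by (simp add: fun_det_transpose[of n g])
      let ?T = "coord_map n (\<lambda>i j. g j i)"
      obtain b where "\<And>i j. i < n \<Longrightarrow> j < n \<Longrightarrow> (\<Sum>k<n. g k i * b k j) = (if i = j then 1 else 0)"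
        using fun_det_inverse[OF det] by metis
      then have surj: "?T (coord_map n b x) = x" if "x \<in> space (lborel_coord n)" for x
        using that by (intro coord_map_inverse) auto
      have im: "orth_proj W ` lincomb_list bs ` A = lincomb_list cs ` ?T ` A" for A
        by (simp add: image_image proj)
      have "?T ` space (lborel_coord n) = space (lborel_coord n)"
      proof
        show "space (lborel_coord n) \<subseteq> ?T ` space (lborel_coord n)"
          using surj coord_map_space by (metis (no_types, lifting) image_eqI subsetI)
      qed (use coord_map_space in auto)
      then have "orth_proj W ` V = W"
        using lincomb_list_image[OF bs(1)] lincomb_list_image[OF cs(1)] im[of "space (lborel_coord n)"]
        by (simp add: bs(2) cs(2))
      then show ?thesis
        unfolding A(2) im using completion_coord_map_image[OF det A(1)] A(1)
        by (simp add: vol_V vol_W fun_det_transpose[of n g])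
    qed
  qed
  also have "\<bar>fun_det n g\<bar> = \<bar>fun_det n (\<lambda>i j. inner (es ! i) (fs ! j))\<bar>"
  proof -
    \<comment> \<open>The matrix that relates two orthonormal bases is orthogonal.\<close>
    have change: "\<bar>fun_det n (\<lambda>i j. inner (as ! i) (as' ! j))\<bar> = 1"
      if as: "orthonormal_basis_of as U" "orthonormal_basis_of as' U" "length as = n" "length as' = n"
      for as as' :: "'a list" and U
    proof -
      have "fun_det n (\<lambda>i j. \<Sum>k<n. inner (as ! i) (as' ! k) * inner (as' ! k) (as ! j)) = fun_det n (\<lambda>i j. if i = j then 1 else 0)"
        by (rule fun_det_cong)
          (use orthonormal_basis_of_parseval[OF as(2) orthonormal_basis_of_nth_mem[OF as(1)]] as in \<open>auto simp: orthonormal_basis_of_def\<close>)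
      moreover have "fun_det n (\<lambda>k j. inner (as' ! k) (as ! j)) = fun_det n (\<lambda>i j. inner (as ! i) (as' ! j))"
        by (subst fun_det_transpose[symmetric]) (simp add: inner_commute)
      ultimately have "fun_det n (\<lambda>i j. inner (as ! i) (as' ! j)) * fun_det n (\<lambda>i j. inner (as ! i) (as' ! j)) = 1"
        by (simp add: fun_det_mult fun_det_one)
      then show ?thesis by (metis abs_mult_self_eq abs_one abs_square_eq_1 power2_eq_square)
    qed
    have "fun_det n (\<lambda>i j. inner (es ! i) (fs ! j))
      = fun_det n (\<lambda>i j. \<Sum>k<n. inner (es ! i) (bs ! k) * inner (bs ! k) (fs ! j))"
      using orthonormal_basis_of_parseval[OF bs(1)] orthonormal_basis_of_nth_mem[OF es] len bs(2)
      by (intro fun_det_cong) auto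
    also have "\<dots> = fun_det n (\<lambda>i j. inner (es ! i) (bs ! j)) * fun_det n (\<lambda>i j. inner (bs ! i) (fs ! j))"
      by (rule fun_det_mult)
    also have "fun_det n (\<lambda>i j. inner (bs ! i) (fs ! j))
      = fun_det n (\<lambda>i j. \<Sum>k<n. inner (bs ! i) (cs ! k) * inner (cs ! k) (fs ! j))"
    proof (rule fun_det_cong)
      fix i j assume "i < n" "j < n"
      then show "inner (bs ! i) (fs ! j) = (\<Sum>k<n. inner (bs ! i) (cs ! k) * inner (cs ! k) (fs ! j))"
        using orthonormal_basis_of_parseval[OF cs(1) orthonormal_basis_of_nth_mem[OF fs, of j], of "bs ! i"]
          len cs(2) by (simp add: inner_commute mult.commute)
    qed
    also have "\<dots> = fun_det n g * fun_det n (\<lambda>i j. inner (cs ! i) (fs ! j))"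
      unfolding g_def by (rule fun_det_mult)
    finally show ?thesis
      by (simp add: abs_mult change[OF es bs(1) len(1) bs(2)] change[OF cs(1) fs cs(2) len(2)])
  qed
  finally show ?thesis .
qed

section \<open>Complex subspaces as real subspaces\<close>

text \<open>
  A complex matrix \<open>A + \<i>B\<close> acts on real coordinates as the block matrix with rows \<open>(A, -B)\<close> and
  \<open>(B, A)\<close>. Conjugation by a unitriangular complex block matrix makes this block lower triangular, with
  diagonal blocks \<open>A + \<i>B\<close> and \<open>A - \<i>B\<close>.
\<close>

lemma fun_det_realify:
  fixes g :: "nat \<Rightarrow> nat \<Rightarrow> complex"
  assumes "\<And>i j. i < p \<Longrightarrow> j < p \<Longrightarrow> r i j = Re (g i j)"
    and "\<And>i j. i < p \<Longrightarrow> j < p \<Longrightarrow> r i (p + j) = - Im (g i j)"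
    and "\<And>i j. i < p \<Longrightarrow> j < p \<Longrightarrow> r (p + i) j = Im (g i j)"
    and "\<And>i j. i < p \<Longrightarrow> j < p \<Longrightarrow> r (p + i) (p + j) = Re (g i j)"
  shows "fun_det (p + p) r = (cmod (fun_det p g))\<^sup>2"
proof -
  let ?G = "Matrix.mat p p (\<lambda>(i, j). g i j)"
  let ?G' = "Matrix.mat p p (\<lambda>(i, j). cnj (g i j))"
  let ?R = "Matrix.mat p p (\<lambda>(i, j). complex_of_real (Re (g i j)))"
  let ?I = "Matrix.mat p p (\<lambda>(i, j). complex_of_real (Im (g i j)))"
  let ?M = "four_block_mat ?R (- ?I) ?I ?R"
  let ?U = "four_block_mat (1\<^sub>m p) (\<i> \<cdot>\<^sub>m 1\<^sub>m p) (0\<^sub>m p p) (1\<^sub>m p)"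
  let ?L = "four_block_mat ?G (0\<^sub>m p p) ?I ?G'"
  have G: "?G = ?R + \<i> \<cdot>\<^sub>m ?I" and G': "?G' = ?R - \<i> \<cdot>\<^sub>m ?I"
    by (rule Matrix.eq_matI; auto simp: complex_eq_iff)+
  have one: "- ?I + \<i> \<cdot>\<^sub>m ?R = \<i> \<cdot>\<^sub>m ?G"
    by (rule Matrix.eq_matI) (auto simp: complex_eq_iff)
  have two: "\<i> \<cdot>\<^sub>m ?I + ?G' = ?R"
    by (rule Matrix.eq_matI) (auto simp: complex_eq_iff)
  have "?U * ?M = four_block_mat (?R + \<i> \<cdot>\<^sub>m ?I) (- ?I + \<i> \<cdot>\<^sub>m ?R) ?I ?R"
    by (subst mult_four_block_mat[of _ p p _ p _ p _ _ p _ p]) (auto simp: mult_smult_assoc_mat[of _ p p])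
  also have "\<dots> = ?L * ?U"
    unfolding one G[symmetric]
    by (subst mult_four_block_mat[of _ p p _ p _ p _ _ p _ p])
       (auto simp: mult_smult_distrib[of _ p p _ p] right_mult_one_mat[of _ p p] two)
  finally have "?U * ?M = ?L * ?U" .
  then have "Determinant.det (?U * ?M) = Determinant.det (?L * ?U)" by (rule arg_cong)
  moreover have "Determinant.det (?U * ?M) = Determinant.det ?U * Determinant.det ?M"
    by (rule Determinant.det_mult) auto
  moreover have "Determinant.det (?L * ?U) = Determinant.det ?L * Determinant.det ?U"
    by (rule Determinant.det_mult) auto
  moreover have "Determinant.det ?U = 1"
    by (subst det_four_block_mat_lower_left_zero[of _ p _ p]) auto
  moreover have "Determinant.det ?L = Determinant.det ?G * Determinant.det ?G'"
    by (subst det_four_block_mat_upper_right_zero[of _ p _ p]) auto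
  moreover have "comm_ring_hom cnj" by unfold_locales auto
  from fun_det_hom[OF this, of p g] have "Determinant.det ?G' = cnj (Determinant.det ?G)"
    unfolding fun_det_def .
  ultimately have "Determinant.det ?M = of_real ((cmod (Determinant.det ?G))\<^sup>2)"
    by (simp add: complex_norm_square del: of_real_power)
  moreover have "?M = Matrix.mat (p + p) (p + p) (\<lambda>(i, j). complex_of_real (r i j))"
  proof (rule Matrix.eq_matI, goal_cases)
    case (1 i j)
    then show ?case
      using assms(1)[of i j] assms(2)[of i "j - p"] assms(3)[of "i - p" j] assms(4)[of "i - p" "j - p"]
      by auto
  qed auto
  ultimately have "fun_det (p + p) (\<lambda>i j. complex_of_real (r i j)) = of_real ((cmod (fun_det p g))\<^sup>2)"
    unfolding fun_det_def by simp
  moreover have "fun_det (p + p) (\<lambda>i j. complex_of_real (r i j)) = of_real (fun_det (p + p) r)"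
    by (rule fun_det_hom) unfold_locales
  ultimately show ?thesis
    by (metis of_real_eq_iff)
qed

interpretation complex_hermitian:
  hermitian_space "scaleC :: complex \<Rightarrow> 'a::complex_inner \<Rightarrow> 'a" cnj cinner
proof unfold_locales
  fix x :: 'a assume x: "x \<noteq> 0"
  have "Im (cinner x x) = 0" using cinner_commute[of x x] by (simp add: complex_eq_iff)
  then have xx: "cinner x x = of_real ((norm x)\<^sup>2)"
    by (simp add: complex_eq_iff inner_eq_Re_cinner[symmetric] dot_square_norm)
  let ?c = "complex_of_real (1 / norm x)"
  have "cinner (?c *\<^sub>C x) (?c *\<^sub>C x) = ?c * cinner (?c *\<^sub>C x) x" by (rule cinner_scaleC_right)
  also have "cinner (?c *\<^sub>C x) x = cnj (?c * cinner x x)"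
    using cinner_commute[of "?c *\<^sub>C x" x] cinner_scaleC_right[of x ?c x] by simp
  finally have "cinner (?c *\<^sub>C x) (?c *\<^sub>C x) = 1"
    using x by (simp add: xx power2_eq_square)
  then show "\<exists>c. cinner (c *\<^sub>C x) (c *\<^sub>C x) = 1" by blast
next
  fix x y :: 'a
  show "cinner x y = cnj (cinner y x)" by (rule cinner_commute)
qed (simp_all add: cinner_add_right cinner_scaleC_right)

text \<open>
  The complex span of an orthonormal list, as a real subspace, has the real orthonormal basis that
  consists of the vectors of the list and their multiples by \<open>\<i>\<close>.
\<close>

lemma orthonormal_basis_of_realify:
  assumes on: "complex_hermitian.orthonormal_list es"
  shows "orthonormal_basis_of (es @ map (scaleC \<i>) es) (complex_vector.span (set es))"
  unfolding orthonormal_basis_of_def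
proof (intro conjI allI impI)
  let ?bs = "es @ map (scaleC \<i>) es" and ?U = "complex_vector.span (set es)"
  have sub: "subspace ?U"
    unfolding subspace_def scaleR_scaleC
    by (auto intro: complex_vector.span_zero complex_vector.span_add complex_vector.span_scale)
  show "span (set ?bs) = ?U"
  proof
    show "span (set ?bs) \<subseteq> ?U"
      by (rule span_minimal[OF _ sub])
        (auto intro: complex_vector.span_base complex_vector.span_scale)
    show "?U \<subseteq> span (set ?bs)"
    proof
      fix v assume "v \<in> ?U"
      then have v: "v = (\<Sum>j<length es. cinner (es ! j) v *\<^sub>C (es ! j))"
        by (rule complex_hermitian.orthonormal_list_expand[OF on])
      have split: "c *\<^sub>C x = Re c *\<^sub>R x + Im c *\<^sub>R (\<i> *\<^sub>C x)" for c and x :: 'a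
      proof -
        have "Re c *\<^sub>R x + Im c *\<^sub>R (\<i> *\<^sub>C x) = (of_real (Re c) + of_real (Im c) * \<i>) *\<^sub>C x"
          by (simp only: scaleR_scaleC scaleC_scaleC scaleC_add_left)
        also have "of_real (Re c) + of_real (Im c) * \<i> = c"
          by (simp add: complex_eq_iff)
        finally show ?thesis by simp
      qed
      have "cinner (es ! j) v *\<^sub>C (es ! j) \<in> span (set ?bs)" if "j < length es" for j
      proof -
        have "es ! j \<in> span (set ?bs)" "\<i> *\<^sub>C (es ! j) \<in> span (set ?bs)"
          using that by (auto intro!: span_base)
        then show ?thesis
          unfolding split[of "cinner (es ! j) v"] by (intro span_add span_scale)
      qed
      then have "(\<Sum>j<length es. cinner (es ! j) v *\<^sub>C (es ! j)) \<in> span (set ?bs)"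
        by (intro span_sum) simp
      then show "v \<in> span (set ?bs)" by (subst v)
    qed
  qed
  fix i j assume ij: "i < length ?bs" "j < length ?bs"
  show "inner (?bs ! i) (?bs ! j) = (if i = j then 1 else 0)"
    using on ij unfolding inner_eq_Re_cinner complex_hermitian.orthonormal_list_def
    by (auto simp: nth_append complex_hermitian.ip_scale_left complex_hermitian.ip_scale_right)
qed

lemma projection_factor_eq_cmod_det:
  assumes es: "complex_hermitian.orthonormal_list es" "length es = p"
    and fs: "complex_hermitian.orthonormal_list fs" "length fs = p"
  shows "projection_factor (complex_vector.span (set es)) (complex_vector.span (set fs))
    = (cmod (complex_hermitian.gram_det es fs p))\<^sup>2"
proof -
  let ?es = "es @ map (scaleC \<i>) es" and ?fs = "fs @ map (scaleC \<i>) fs"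
  have "projection_factor (complex_vector.span (set es)) (complex_vector.span (set fs))
      = \<bar>fun_det (p + p) (\<lambda>i j. inner (?es ! i) (?fs ! j))\<bar>"
    by (rule projection_factor_eq_abs_det[OF orthonormal_basis_of_realify[OF es(1)]
          orthonormal_basis_of_realify[OF fs(1)]]) (use es fs in simp_all)
  also have "fun_det (p + p) (\<lambda>i j. inner (?es ! i) (?fs ! j))
      = (cmod (complex_hermitian.gram_det es fs p))\<^sup>2"
    unfolding complex_hermitian.gram_det_def
    by (rule fun_det_realify)
       (use es(2) fs(2) in \<open>auto simp: inner_eq_Re_cinner nth_append
         complex_hermitian.ip_scale_left complex_hermitian.ip_scale_right\<close>)
  finally show ?thesis by simp
qed

section \<open>The two cases of the formula\<close>

lemma projection_factor_real:
  fixes B V W :: "'a::real_inner set"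
  assumes X: "finite B" "span B = UNIV" and sub: "subspace V" "subspace W"
    and dim: "dim V = p" "dim W = p"
    and \<nu>: "\<nu> \<in> blades scaleR p V" "\<nu> \<noteq> pvector scaleR p 0"
    and \<omega>: "\<omega> \<in> blades scaleR p W" "\<omega> \<noteq> pvector scaleR p 0"
  shows "projection_factor V W = \<bar>pvec_inner p \<nu> \<omega>\<bar> / (pvec_norm p \<nu> * pvec_norm p \<omega>)"
proof -
  obtain es where es: "real_hermitian.orthonormal_list es" "span (set es) = V" "length es = p"
    using real_hermitian.orthonormal_basis_exists[OF X sub(1)] dim by metis
  obtain fs where fs: "real_hermitian.orthonormal_list fs" "span (set fs) = W" "length fs = p"
    using real_hermitian.orthonormal_basis_exists[OF X sub(2)] dim by metis
  obtain a b where ab: "a \<noteq> 0" "b \<noteq> 0"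
    "pvec_inner p \<nu> \<omega> = a * b * real_hermitian.gram_det es fs p"
    "pvec_inner p \<nu> \<nu> = a * a" "pvec_inner p \<omega> \<omega> = b * b"
    using real_hermitian.blade_inner_factor[OF es(1,3) fs(1,3), of \<nu> \<omega>] \<nu> \<omega> es(2) fs(2)
    unfolding pvec_inner_def by metis
  have "projection_factor V W = \<bar>real_hermitian.gram_det es fs p\<bar>"
    unfolding real_hermitian.gram_det_def
    by (rule projection_factor_eq_abs_det[of es V fs W p]) (use es fs in \<open>auto simp: orthonormal_basis_of_iff\<close>)
  then show ?thesis
    using ab by (simp add: pvec_norm_def abs_mult)
qed

lemma projection_factor_complex:
  fixes B V W :: "'b::complex_inner set"
  assumes X: "finite B" "complex_vector.span B = UNIV"
    and sub: "complex_vector.subspace V" "complex_vector.subspace W"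
    and dim: "complex_vector.dim V = p" "complex_vector.dim W = p"
    and \<nu>: "\<nu> \<in> blades scaleC p V" "\<nu> \<noteq> pvector scaleC p 0"
    and \<omega>: "\<omega> \<in> blades scaleC p W" "\<omega> \<noteq> pvector scaleC p 0"
  shows "projection_factor V W =
    (cmod (pvec_cinner p \<nu> \<omega>))\<^sup>2 / ((pvec_cnorm p \<nu>)\<^sup>2 * (pvec_cnorm p \<omega>)\<^sup>2)"
proof -
  obtain es where es: "complex_hermitian.orthonormal_list es" "complex_vector.span (set es) = V" "length es = p"
    using complex_hermitian.orthonormal_basis_exists[OF X sub(1)] dim by metis
  obtain fs where fs: "complex_hermitian.orthonormal_list fs" "complex_vector.span (set fs) = W" "length fs = p"
    using complex_hermitian.orthonormal_basis_exists[OF X sub(2)] dim by metis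
  obtain a b where ab: "a \<noteq> 0" "b \<noteq> 0"
    "pvec_cinner p \<nu> \<omega> = cnj a * b * complex_hermitian.gram_det es fs p"
    "pvec_cinner p \<nu> \<nu> = cnj a * a" "pvec_cinner p \<omega> \<omega> = cnj b * b"
    using complex_hermitian.blade_inner_factor[OF es(1,3) fs(1,3), of \<nu> \<omega>] \<nu> \<omega> es(2) fs(2)
    unfolding pvec_cinner_def by metis
  have sq: "(sqrt (Re (cnj c * c)))\<^sup>2 = (cmod c)\<^sup>2" for c
    unfolding cmod_power2 by (simp add: power2_eq_square)
  have "projection_factor V W = (cmod (complex_hermitian.gram_det es fs p))\<^sup>2"
    using projection_factor_eq_cmod_det[OF es(1,3) fs(1,3)] es(2) fs(2) by simp
  then show ?thesis
    using ab(1,2) unfolding pvec_cnorm_def ab(3-5) sq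
    by (simp add: norm_mult power_mult_distrib)
qed

theorem theorem2p8:
  shows
    "(\<forall>(V :: 'a::real_inner set) W p \<nu> \<omega>.
        (\<exists>B :: 'a set. finite B \<and> span B = UNIV) \<and>
        subspace V \<and> subspace W \<and> dim V = p \<and> dim W = p \<and>
        \<nu> \<in> blades scaleR p V \<and> \<nu> \<noteq> pvector scaleR p 0 \<and>
        \<omega> \<in> blades scaleR p W \<and> \<omega> \<noteq> pvector scaleR p 0 \<longrightarrow>
        projection_factor V W = \<bar>pvec_inner p \<nu> \<omega>\<bar> / (pvec_norm p \<nu> * pvec_norm p \<omega>)) \<and>
     (\<forall>(V :: 'b::complex_inner set) W p \<nu> \<omega>.
        (\<exists>B :: 'b set. finite B \<and> complex_vector.span B = UNIV) \<and>
        complex_vector.subspace V \<and> complex_vector.subspace W \<and>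
        complex_vector.dim V = p \<and> complex_vector.dim W = p \<and>
        \<nu> \<in> blades scaleC p V \<and> \<nu> \<noteq> pvector scaleC p 0 \<and>
        \<omega> \<in> blades scaleC p W \<and> \<omega> \<noteq> pvector scaleC p 0 \<longrightarrow>
        projection_factor V W =
          (cmod (pvec_cinner p \<nu> \<omega>))\<^sup>2 / ((pvec_cnorm p \<nu>)\<^sup>2 * (pvec_cnorm p \<omega>)\<^sup>2))"
proof (intro conjI allI impI; (elim conjE exE)?)
qed (rule projection_factor_real projection_factor_complex; assumption)+

end
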